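(* Let $F$ be an e-annotated sequent. Then $F$ is an expansion-net (i.e. $F$ is derivable in the annotated sequent calculus $\mathbf{LK}^*_e$) if and only if $F$ is AC-correct.
   Context: **Formulae.** Formulae of classical propositional logic over a countable set of proposition symbols: $A ::= a \mid \bar a \mid \top \mid \bot \mid A\land A \mid A\lor A$ ($a$ a proposition symbol; $a,\bar a$ are dual atoms). **Expansion trees.** Fix a set of wire symbols; wire variables come in dual pairs $x,\bar x$ (one pair for each wire symbol; $x$ positive, $\bar x$ negative). Propositional expansion trees $t$ and witnesses $w$ are given by $$t ::= 1 \mid (w+\dots+w) \mid (t\lor t)\mid (t\lor * )\mid ( *\lor t),\qquad w ::= x\mid \bar x\mid t\otimes t,$$ where $(w_1+\dots+w_n)$ is a nonempty finite formal (unordered) sum, called an expansion (trivial if $n=1$). **Types.** A type is a formula or a witness type: $[a]$, $[\bar a]$, or $A\otimes B$ ($A,B$ formulae). Typing rules: $x:[p]$ and $\bar x:[\bar p]$ ($p$ any proposition symbol); $1:\top$; if $t:A$ then $(t\lor * ):A\lor B$ and, if $t:B$, $( *\lor t):A\lor B$, the other disjunct being arbitrary; if $t:A$, $s:B$ then $(t\lor s):A\lor B$ and $t\otimes s:A\otimes B$; if all $w_i:[p]$ (resp. $[\bar p]$, resp. $A\otimes B$) then $(w_1+\dots+w_n)$ has type $p$ (resp. $\bar p$, resp. $A\land B$). **Typed forests.** A typed forest is a finite nonempty collection $F$ of typed expansion trees and typed witnesses in which each wire variable occurs at most once, and $x$ occurs iff $\bar x$ occurs. (Dual wire variables are typed with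 the dual witness types $[p]$, $[\bar p]$ of the same proposition symbol.) It is an e-annotated sequent if all its members are expansion trees (none is a witness). **AC-correctness.** View $F$ as a forest whose nodes are the subterm occurrences, including the occurrences of $*$; the successors of $t\lor s$ or $t\otimes s$ are $t$ and $s$, those of $(t\lor * )$ or $( *\lor t)$ are $t$ and $*$, those of $(w_1+\dots+w_n)$ are the $w_i$; wire variables, $1$ and $*$ are leaves. The graph of $F$ has these nodes, an edge from each node to its predecessor, and an edge from $x$ to $\bar x$ for each wire variable $x$ in $F$. A node is switched if it is an expansion or a node $t\lor s$ with neither $t$ nor $s$ equal to $*$. A switching $\sigma$ chooses one successor of each switched node. The switching graph $\sigma(F)$ is the undirected graph obtained from the graph of $F$ by deleting, for every switched node, all edges coming into it from successors not chosen by $\sigma$, and forgetting directions. $F$ is AC-correct if $\sigma(F)$ is acyclic for every switching $\sigma$. **The calculus $\mathbf{LK}^*_e$** derives e-annotated sequents (premisses of binary rules have disjoint wire variables; order of members is irrelevant). Axioms: $1:\top$; and $(\bar x):\bar p,\ (x):p$. Rules: - mix: from $F$ and $G$ infer $F,G$; - $\lor$: from $F,t:A,s:B$ infer $F,(t\lor s):A\lor B$; - $\lor_0$: from $F,t:A$ infer $F,(t\lor * ):A\lor B$; - $\lor_1$: from $F,s:B$ infer $F,( *\lor s):A\lor B$; - $\land$: from $F,t:A$ and $G,s:B$ infer $F,G,(t\otimes s):A\land B$ (a trivial expansion); - contraction: from $F,t:C,s:C$ infer $F,t+s:C$, where $C$ is $p$, $\bar p$ or a conjunction $A\land B$, and $t+s$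 is the expansion formed by joining the two formal sums. An expansion-net is an e-annotated sequent derivable in $\mathbf{LK}^*_e$. *)

theory Defs
  imports "HOL-Library.Multiset" "HOL-Library.Countable"
begin

datatype 'a form =
    Atom 'a
  | NAtom 'a
  | Top
  | Bot
  | And "'a form" "'a form"
  | Or "'a form" "'a form"

datatype 'x wire = PosW 'x | NegW 'x

text \<open>
  \<open>OrL t\<close> and \<open>OrR t\<close> stand for \<open>(t \<or> *)\<close> and \<open>(* \<or> t)\<close>. The formal sums of \<open>Exp\<close> are
  unordered, hence multisets; that they are nonempty is imposed by the typing rule \<open>expansion\<close>
  below.
\<close>
datatype 'x tree =
    One
  | Exp "'x wit multiset"
  | Disj "'x tree" "'x tree"
  | OrL "'x tree"
  | OrR "'x tree"
and 'x wit =
    Wire "'x wire"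
  | Tensor "'x tree" "'x tree"

datatype 'a wtype = PosT 'a | NegT 'a | TensorT "'a form" "'a form"

fun sum_type :: "'a wtype \<Rightarrow> 'a form" where
  "sum_type (PosT p) = Atom p"
| "sum_type (NegT p) = NAtom p"
| "sum_type (TensorT A B) = And A B"

text \<open>
  A context \<open>\<Gamma>\<close> gives the proposition symbol of each wire symbol. Typing all members of a forest
  in one common context says that dual wire variables get the dual witness types of the same
  proposition symbol.
\<close>
inductive typed_tree :: "('x \<Rightarrow> 'a) \<Rightarrow> 'x tree \<Rightarrow> 'a form \<Rightarrow> bool"
  and typed_wit :: "('x \<Rightarrow> 'a) \<Rightarrow> 'x wit \<Rightarrow> 'a wtype \<Rightarrow> bool"
  for \<Gamma> :: "'x \<Rightarrow> 'a" where
  pos_wire: "typed_wit \<Gamma> (Wire (PosW x)) (PosT (\<Gamma> x))"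
| neg_wire: "typed_wit \<Gamma> (Wire (NegW x)) (NegT (\<Gamma> x))"
| tensor: "typed_tree \<Gamma> t A \<Longrightarrow> typed_tree \<Gamma> s B \<Longrightarrow> typed_wit \<Gamma> (Tensor t s) (TensorT A B)"
| one: "typed_tree \<Gamma> One Top"
| disj: "typed_tree \<Gamma> t A \<Longrightarrow> typed_tree \<Gamma> s B \<Longrightarrow> typed_tree \<Gamma> (Disj t s) (Or A B)"
| disj_left: "typed_tree \<Gamma> t A \<Longrightarrow> typed_tree \<Gamma> (OrL t) (Or A B)"
| disj_right: "typed_tree \<Gamma> t B \<Longrightarrow> typed_tree \<Gamma> (OrR t) (Or A B)"
| expansion: "M \<noteq> {#} \<Longrightarrow> (\<forall>w\<in>#M. typed_wit \<Gamma> w W) \<Longrightarrow> typed_tree \<Gamma> (Exp M) (sum_type W)"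

primrec wires_tree :: "'x tree \<Rightarrow> 'x wire multiset"
  and wires_wit :: "'x wit \<Rightarrow> 'x wire multiset" where
  "wires_tree One = {#}"
| "wires_tree (Exp M) = sum_mset (image_mset wires_wit M)"
| "wires_tree (Disj t s) = wires_tree t + wires_tree s"
| "wires_tree (OrL t) = wires_tree t"
| "wires_tree (OrR t) = wires_tree t"
| "wires_wit (Wire v) = {#v#}"
| "wires_wit (Tensor t s) = wires_tree t + wires_tree s"

datatype ('a, 'x) member = TreeM "'x tree" "'a form" | WitM "'x wit" "'a wtype"

type_synonym ('a, 'x) forest = "('a, 'x) member multiset"

fun typed_member :: "('x \<Rightarrow> 'a) \<Rightarrow> ('a, 'x) member \<Rightarrow> bool" where
  "typed_member \<Gamma> (TreeM t A) = typed_tree \<Gamma> t A"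
| "typed_member \<Gamma> (WitM w W) = typed_wit \<Gamma> w W"

fun wires_member :: "('a, 'x) member \<Rightarrow> 'x wire multiset" where
  "wires_member (TreeM t A) = wires_tree t"
| "wires_member (WitM w W) = wires_wit w"

definition wires :: "('a, 'x) forest \<Rightarrow> 'x wire multiset" where
  "wires F = sum_mset (image_mset wires_member F)"

definition typed_forest :: "('a, 'x) forest \<Rightarrow> bool" where
  "typed_forest F \<longleftrightarrow>
     F \<noteq> {#} \<and>
     (\<exists>\<Gamma>. \<forall>m\<in>#F. typed_member \<Gamma> m) \<and>
     (\<forall>v. count (wires F) v \<le> 1) \<and>
     (\<forall>x. PosW x \<in># wires F \<longleftrightarrow> NegW x \<in># wires F)"

definition e_annotated_sequent :: "('a, 'x) forest \<Rightarrow> bool" where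
  "e_annotated_sequent F \<longleftrightarrow> typed_forest F \<and> (\<forall>m\<in>#F. \<exists>t A. m = TreeM t A)"

subsection \<open>AC-correctness\<close>

datatype 'x subterm = TreeS "'x tree" | WitS "'x wit" | Star

text \<open>
  A node records where a subterm occurs. The \<open>k\<close>-th copy of a repeated element of a
  multiset (a member of the forest, or a summand of an expansion) is told apart by the number
  \<open>k\<close>, which is smaller than the multiplicity of the element.
\<close>
datatype 'x step = LeftS | RightS | SummandS "'x wit" nat

datatype ('a, 'x) node = Root "('a, 'x) member" nat | Succ "('a, 'x) node" "'x step"

inductive child :: "'x subterm \<Rightarrow> 'x step \<Rightarrow> 'x subterm \<Rightarrow> bool" where
  "child (TreeS (Disj t s)) LeftS (TreeS t)"
| "child (TreeS (Disj t s)) RightS (TreeS s)"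
| "child (TreeS (OrL t)) LeftS (TreeS t)"
| "child (TreeS (OrL t)) RightS Star"
| "child (TreeS (OrR t)) LeftS Star"
| "child (TreeS (OrR t)) RightS (TreeS t)"
| "child (WitS (Tensor t s)) LeftS (TreeS t)"
| "child (WitS (Tensor t s)) RightS (TreeS s)"
| "k < count M w \<Longrightarrow> child (TreeS (Exp M)) (SummandS w k) (WitS w)"

fun member_subterm :: "('a, 'x) member \<Rightarrow> 'x subterm" where
  "member_subterm (TreeM t A) = TreeS t"
| "member_subterm (WitM w W) = WitS w"

inductive occurs :: "('a, 'x) forest \<Rightarrow> ('a, 'x) node \<Rightarrow> 'x subterm \<Rightarrow> bool"
  for F :: "('a, 'x) forest" where
  "k < count F m \<Longrightarrow> occurs F (Root m k) (member_subterm m)"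
| "occurs F n u \<Longrightarrow> child u s v \<Longrightarrow> occurs F (Succ n s) v"

definition nodes :: "('a, 'x) forest \<Rightarrow> ('a, 'x) node set" where
  "nodes F = {n. \<exists>u. occurs F n u}"

definition successors :: "('a, 'x) forest \<Rightarrow> ('a, 'x) node \<Rightarrow> ('a, 'x) node set" where
  "successors F n = {Succ n s | s. Succ n s \<in> nodes F}"

definition edges :: "('a, 'x) forest \<Rightarrow> (('a, 'x) node \<times> ('a, 'x) node) set" where
  "edges F =
     {(m, n). n \<in> nodes F \<and> m \<in> successors F n} \<union>
     {(m, n). \<exists>x. occurs F m (WitS (Wire (PosW x))) \<and> occurs F n (WitS (Wire (NegW x)))}"

definition switched :: "('a, 'x) forest \<Rightarrow> ('a, 'x) node \<Rightarrow> bool" where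
  "switched F n \<longleftrightarrow>
     (\<exists>M. occurs F n (TreeS (Exp M))) \<or> (\<exists>t s. occurs F n (TreeS (Disj t s)))"

text \<open>The values of a switching at nodes that are not switched are irrelevant.\<close>
definition switching :: "('a, 'x) forest \<Rightarrow> (('a, 'x) node \<Rightarrow> ('a, 'x) node) \<Rightarrow> bool" where
  "switching F \<sigma> \<longleftrightarrow> (\<forall>n. switched F n \<longrightarrow> \<sigma> n \<in> successors F n)"

text \<open>
  The vertex set of the switching graph is \<open>nodes F\<close>; only its edges matter for acyclicity.
\<close>
definition switching_graph ::
  "('a, 'x) forest \<Rightarrow> (('a, 'x) node \<Rightarrow> ('a, 'x) node) \<Rightarrow> ('a, 'x) node set set" where
  "switching_graph F \<sigma> =
     (\<lambda>(m, n). {m, n}) `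
       (edges F - {(m, n). switched F n \<and> m \<in> successors F n \<and> m \<noteq> \<sigma> n})"

text \<open>
  Distinct edges of the graph of a forest join distinct pairs of distinct nodes, so there are
  neither loops nor parallel edges, and cycles have length at least 3.
\<close>
definition is_cycle :: "'v set set \<Rightarrow> 'v list \<Rightarrow> bool" where
  "is_cycle E vs \<longleftrightarrow>
     3 \<le> length vs \<and> distinct vs \<and>
     (\<forall>i < length vs. {vs ! i, vs ! (Suc i mod length vs)} \<in> E)"

definition acyclic_graph :: "'v set set \<Rightarrow> bool" where
  "acyclic_graph E \<longleftrightarrow> (\<nexists>vs. is_cycle E vs)"

definition AC_correct :: "('a, 'x) forest \<Rightarrow> bool" where
  "AC_correct F \<longleftrightarrow> (\<forall>\<sigma>. switching F \<sigma> \<longrightarrow> acyclic_graph (switching_graph F \<sigma>))"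

subsection \<open>The annotated sequent calculus\<close>

definition contractible :: "'a form \<Rightarrow> bool" where
  "contractible C \<longleftrightarrow> (\<exists>p. C = Atom p) \<or> (\<exists>p. C = NAtom p) \<or> (\<exists>A B. C = And A B)"

inductive LK_e :: "('a, 'x) forest \<Rightarrow> bool" where
  top_ax: "LK_e {#TreeM One Top#}"
| id_ax: "LK_e {#TreeM (Exp {#Wire (NegW x)#}) (NAtom p), TreeM (Exp {#Wire (PosW x)#}) (Atom p)#}"
| mix: "LK_e F \<Longrightarrow> LK_e G \<Longrightarrow> set_mset (wires F) \<inter> set_mset (wires G) = {} \<Longrightarrow> LK_e (F + G)"
| or: "LK_e (F + {#TreeM t A, TreeM s B#}) \<Longrightarrow> LK_e (F + {#TreeM (Disj t s) (Or A B)#})"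
| or0: "LK_e (F + {#TreeM t A#}) \<Longrightarrow> LK_e (F + {#TreeM (OrL t) (Or A B)#})"
| or1: "LK_e (F + {#TreeM s B#}) \<Longrightarrow> LK_e (F + {#TreeM (OrR s) (Or A B)#})"
| "and": "LK_e (F + {#TreeM t A#}) \<Longrightarrow> LK_e (G + {#TreeM s B#}) \<Longrightarrow>
    set_mset (wires (F + {#TreeM t A#})) \<inter> set_mset (wires (G + {#TreeM s B#})) = {} \<Longrightarrow>
    LK_e (F + G + {#TreeM (Exp {#Tensor t s#}) (And A B)#})"
| contraction: "LK_e (F + {#TreeM (Exp M) C, TreeM (Exp N) C#}) \<Longrightarrow> contractible C \<Longrightarrow>
    LK_e (F + {#TreeM (Exp (M + N)) C#})"

definition expansion_net :: "('a, 'x) forest \<Rightarrow> bool" where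
  "expansion_net F \<longleftrightarrow> e_annotated_sequent F \<and> LK_e F"

end

theory Submission
  imports Defs
begin

text \<open>
  A switching keeps one of the edges from a switched node to its successors. A cycle therefore
  survives in some switching graph iff it nowhere uses two successor edges of one switched node.
  Call two edges at a node equally coloured if they are equal or are successor edges of a switched
  node, and call a cusp a place where a path uses two equally coloured edges in a row. Then a forest
  whose expansions are nonempty is AC-correct iff its graph has no cusp-free cycle
  (\<open>AC_correct_if_acyclic\<close>, \<open>acyclic_if_AC_correct\<close>).

  Both implications are proved inside the graph of the one given forest \<open>F\<close>. A sequent that
  occurs in a derivation of \<open>F\<close> is presented by a \<^emph>\<open>slice\<close>, a multiset of items over nodes of \<open>F\<close>:
  an item is a tree node, or a multiset of witness nodes that stands for an expansion. The second
  kind is needed since contraction cuts an expansion into parts that are no subterms of \<open>F\<close>. The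
  nodes over a slice form a region of the graph, and a rule of the calculus shrinks or divides
  regions, so that no graph ever has to be renamed.

  A derivable slice has a region without cusp-free cycles (\<open>acyclic_slices_if_LK_e\<close>), by induction
  on the derivation. A switched node at the root is linked only to its successors, by edges of one
  colour, and so lies on no cusp-free cycle; nor does a disjunction with a leaf \<open>*\<close>. For
  mix and conjunction, the two premisses have disjoint wires, and derivable sequents contain wires in
  dual pairs; so there is no link between the two regions. Conjunction adds a tensor node, which has
  one neighbour in each region.

  Conversely a slice whose region has no cusp-free cycle is derivable (\<open>LK_e_if_acyclic\<close>), by induction
  on the weight of its sequent. Disjunctions at the root, and expansions with several
  summands, are decomposed by the unary rules. If every member is \<open>1\<close> or a single wire, the sequent is a mix of axioms. What
  remains is the case where all members are \<open>1\<close> or trivial expansions and some are tensors. Then one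
  of these tensors lies on no cycle at all (\<open>splitting_tensor\<close>); removing it separates its two
  arguments, and the rest of the sequent is distributed over two premisses accordingly
  (\<open>splitting_partition\<close>).

  The splitting tensor comes from a version of Yeo's theorem on edge-coloured graphs
  (\<open>splitting_vertex\<close>). For a tensor \<open>w\<close> and a neighbour \<open>b\<close> of it, consider the set of vertices
  on cusp-free paths that start at \<open>w\<close> with an edge to a vertex other than \<open>b\<close>, and choose \<open>w\<close>
  and \<open>b\<close> such that this set is smallest. Suppose a cycle passes through \<open>w\<close>, leaving it by an
  edge that does not go to \<open>b\<close>, and let \<open>k\<close> be its first cusp. If the cycle has as few cusps as
  possible, then no cusp-free path that leaves \<open>k\<close> by an edge of another colour meets the cycle
  between \<open>w\<close> and \<open>k\<close> (\<open>cusp_escape\<close>). One such path goes from \<open>k\<close> down to the tensor \<open>w'\<close> of its tree. All cusp-free paths from \<open>w'\<close> that do not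
  climb back towards \<open>k\<close> prolong this path, and so they reach a set that is smaller by \<open>w\<close> at least.
\<close>

section \<open>Cusp-free cycles in locally coloured graphs\<close>

text \<open>
  The colour of an edge depends on the end at which it is looked at: \<open>same v a b\<close> says that at \<open>v\<close>
  the edges to \<open>a\<close> and to \<open>b\<close> have the same colour. A path is a list of vertices, and a closed path
  repeats its first vertex at the end.
\<close>
locale locally_coloured_graph =
  fixes adj :: "'v \<Rightarrow> 'v \<Rightarrow> bool"
    and same :: "'v \<Rightarrow> 'v \<Rightarrow> 'v \<Rightarrow> bool"
  assumes adj_sym: "adj a b \<Longrightarrow> adj b a"
    and same_refl: "same v a a"
    and same_sym: "same v a b \<Longrightarrow> same v b a"
    and same_trans: "same v a b \<Longrightarrow> same v b c \<Longrightarrow> same v a c"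
begin

fun cusps :: "'v list \<Rightarrow> nat" where
  "cusps (x # y # z # zs) = (if same y x z then 1 else 0) + cusps (y # z # zs)"
| "cusps _ = 0"

definition cusp_free :: "'v list \<Rightarrow> bool" where
  "cusp_free xs \<longleftrightarrow> successively adj xs \<and> cusps xs = 0"

definition cusp_free_cycle :: "'v list \<Rightarrow> bool" where
  "cusp_free_cycle xs \<longleftrightarrow> 3 \<le> length xs \<and> distinct xs \<and> cusp_free (xs @ [hd xs]) \<and>
     \<not> same (hd xs) (last xs) (hd (tl xs))"

lemma cusps_append:
  "cusps (xs @ y # ys) = cusps (xs @ [y]) + cusps (y # ys) +
     (if xs \<noteq> [] \<and> ys \<noteq> [] \<and> same y (last xs) (hd ys) then 1 else 0)"
proof (induction xs rule: induct_list012)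
  case (2 x)
  then show ?case by (cases ys) auto
next
  case (3 x x' xs)
  then show ?case by (cases xs) auto
qed auto

lemma successively_adj_append:
  "successively adj (xs @ y # ys) \<longleftrightarrow> successively adj (xs @ [y]) \<and> successively adj (y # ys)"
  by (auto simp: successively_append_iff)

lemma successively_adj_rev: "successively adj (rev xs) \<longleftrightarrow> successively adj xs"
  by (simp add: successively_rev) (metis adj_sym successively_mono)

lemma cusps_rev: "cusps (rev xs) = cusps xs"
proof (induction xs rule: cusps.induct)
  case (1 x y z zs)
  have "cusps (rev (x # y # z # zs)) = cusps (rev (y # z # zs) @ [x])" by simp
  also have "\<dots> = cusps ((rev zs @ [z]) @ y # [x])" by simp
  also have "\<dots> = cusps (rev (y # z # zs)) + (if same y z x then 1 else 0)"
    by (subst cusps_append) simp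
  finally show ?case using 1 same_sym[of y x z] same_sym[of y z x] by auto
qed auto

text \<open>
  Paths are composed and cut at a vertex \<open>y\<close> that belongs to both pieces: only the two edges that
  meet there can form a new cusp.
\<close>
lemma cusp_free_append:
  "cusp_free (xs @ y # ys) \<longleftrightarrow> cusp_free (xs @ [y]) \<and> cusp_free (y # ys) \<and>
     (xs \<noteq> [] \<and> ys \<noteq> [] \<longrightarrow> \<not> same y (last xs) (hd ys))"
  unfolding cusp_free_def by (auto simp: cusps_append[of xs y ys] successively_adj_append[of xs y ys])

lemma cusp_free_rev: "cusp_free (rev xs) \<longleftrightarrow> cusp_free xs"
  by (simp only: cusp_free_def cusps_rev successively_adj_rev)

lemma cusp_free_cycle_Cons:
  "cusp_free_cycle (x # xs) \<longleftrightarrow> 2 \<le> length xs \<and> distinct (x # xs) \<and> cusp_free (x # xs @ [x]) \<and>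
     \<not> same x (last xs) (hd xs)"
  by (cases xs) (auto simp: cusp_free_cycle_def)

lemma cusp_free_cycle_rotate1:
  assumes "cusp_free_cycle (x # xs)"
  shows "cusp_free_cycle (xs @ [x])"
proof -
  obtain y ys where xs: "xs = y # ys"
    using assms by (cases xs) (auto simp: cusp_free_cycle_Cons)
  have ys: "ys \<noteq> []" using assms xs by (auto simp: cusp_free_cycle_Cons)
  have f: "cusp_free (x # y # (ys @ [x]))" and d: "distinct (x # y # ys)"
    and s: "\<not> same x (last xs) y"
    using assms by (auto simp: cusp_free_cycle_Cons xs)
  have 1: "cusp_free [x, y]" "cusp_free (y # ys @ [x])" "\<not> same y x (hd (ys @ [x]))"
    using f cusp_free_append[of "[x]" y "ys @ [x]"] by auto
  have "cusp_free ((y # ys) @ x # [y])"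
    using 1 s xs by (subst cusp_free_append) auto
  then have "cusp_free ((y # ys @ [x]) @ [y])" by simp
  moreover have "\<not> same y x (hd ys)" using 1 ys by simp
  ultimately show ?thesis using d assms ys unfolding xs
    by (auto simp: cusp_free_cycle_Cons)
qed

lemma cusp_free_cycle_start_at:
  assumes "cusp_free_cycle xs" "v \<in> set xs"
  obtains ys where "cusp_free_cycle (v # ys)" "set (v # ys) = set xs"
proof -
  obtain as bs where xs: "xs = as @ v # bs" using assms(2) by (meson split_list)
  have "cusp_free_cycle (as @ bs') \<Longrightarrow> cusp_free_cycle (bs' @ as)" for bs'
  proof (induction as arbitrary: bs')
    case (Cons a as)
    then show ?case using cusp_free_cycle_rotate1[of a "as @ bs'"] Cons.IH[of "bs' @ [a]"] by simp
  qed simp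
  from this[of "v # bs"] show ?thesis
    using assms(1) that[of "bs @ as"] unfolding xs by auto
qed

text \<open>
  Indices are the form in which cycles of switching graphs are given; the lists used otherwise are
  better suited to cutting and joining.
\<close>
lemma cusps_eq_0_iff:
  "cusps xs = 0 \<longleftrightarrow> (\<forall>i. Suc (Suc i) < length xs \<longrightarrow> \<not> same (xs ! Suc i) (xs ! i) (xs ! Suc (Suc i)))"
proof (induction xs rule: cusps.induct)
  case (1 x y z zs)
  show ?case
  proof
    assume *: "cusps (x # y # z # zs) = 0"
    show "\<forall>i. Suc (Suc i) < length (x # y # z # zs) \<longrightarrow>
        \<not> same ((x # y # z # zs) ! Suc i) ((x # y # z # zs) ! i) ((x # y # z # zs) ! Suc (Suc i))"
    proof (intro allI impI)
      fix i assume "Suc (Suc i) < length (x # y # z # zs)"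
      then show "\<not> same ((x # y # z # zs) ! Suc i) ((x # y # z # zs) ! i) ((x # y # z # zs) ! Suc (Suc i))"
        using * 1 by (cases i) (auto split: if_splits)
    qed
  next
    assume *: "\<forall>i. Suc (Suc i) < length (x # y # z # zs) \<longrightarrow>
        \<not> same ((x # y # z # zs) ! Suc i) ((x # y # z # zs) ! i) ((x # y # z # zs) ! Suc (Suc i))"
    have "\<not> same y x z" using *[rule_format, of 0] by simp
    moreover have "cusps (y # z # zs) = 0"
      unfolding 1
    proof (intro allI impI)
      fix i assume "Suc (Suc i) < length (y # z # zs)"
      then show "\<not> same ((y # z # zs) ! Suc i) ((y # z # zs) ! i) ((y # z # zs) ! Suc (Suc i))"
        using *[rule_format, of "Suc i"] by simp
    qed
    ultimately show "cusps (x # y # z # zs) = 0" by simp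
  qed
qed auto

lemma cusp_free_cycle_iff_nth:
  "cusp_free_cycle xs \<longleftrightarrow> 3 \<le> length xs \<and> distinct xs \<and>
     (\<forall>i < length xs. adj (xs ! i) (xs ! (Suc i mod length xs)) \<and>
        \<not> same (xs ! (Suc i mod length xs)) (xs ! i) (xs ! (Suc (Suc i) mod length xs)))"
proof (cases "3 \<le> length xs")
  case True
  let ?n = "length xs"
  have nth: "(xs @ [hd xs]) ! i = xs ! (i mod ?n)" if "i \<le> ?n" for i
  proof (cases "i = ?n")
    case True
    then show ?thesis using \<open>3 \<le> ?n\<close> by (cases xs) auto
  next
    case False
    then show ?thesis using that by (simp add: nth_append)
  qed
  have ends: "hd xs = xs ! (?n mod ?n)" "last xs = xs ! (?n - 1)" "hd (tl xs) = xs ! (Suc ?n mod ?n)"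
    using True by (cases xs; cases "tl xs"; auto simp: last_conv_nth mod_Suc)+
  have "cusp_free (xs @ [hd xs]) \<longleftrightarrow>
      (\<forall>i < ?n. adj (xs ! i) (xs ! (Suc i mod ?n))) \<and>
      (\<forall>i. Suc i < ?n \<longrightarrow> \<not> same (xs ! (Suc i mod ?n)) (xs ! i) (xs ! (Suc (Suc i) mod ?n)))"
    unfolding cusp_free_def cusps_eq_0_iff successively_conv_nth by (simp add: nth)
  moreover have "(\<forall>i < ?n. P i) \<longleftrightarrow> (\<forall>i. Suc i < ?n \<longrightarrow> P i) \<and> P (?n - 1)" for P
    using True by (metis (no_types, lifting) One_nat_def Suc_lessD Suc_lessI Suc_pred diff_Suc_1
      diff_less less_le_trans zero_less_numeral zero_less_one)
  moreover have "Suc (?n - 1) = ?n" using True by simp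
  ultimately show ?thesis unfolding cusp_free_cycle_def ends using True by auto
qed (simp add: cusp_free_cycle_def)

lemma first_cusp:
  assumes "successively adj (w # xs @ [w])" "cusps (w # xs @ [w]) \<noteq> 0"
  obtains ps k rs where "xs = ps @ k # rs" "cusp_free (w # ps @ [k])"
    "same k (last (w # ps)) (hd (rs @ [w]))"
proof -
  have "\<exists>as k bs. ys = as @ k # bs \<and> as \<noteq> [] \<and> bs \<noteq> [] \<and> cusp_free (as @ [k]) \<and> same k (last as) (hd bs)"
    if "successively adj ys" "cusps ys \<noteq> 0" for ys
    using that
  proof (induction ys rule: cusps.induct)
    case (1 x y z zs)
    show ?case
    proof (cases "same y x z")
      case True
      then show ?thesis using 1
        by (intro exI[of _ "[x]"] exI[of _ y] exI[of _ "z # zs"]) (auto simp: cusp_free_def)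
    next
      case False
      then obtain as k bs where *: "y # z # zs = as @ k # bs" "as \<noteq> []" "bs \<noteq> []" "cusp_free (as @ [k])"
        "same k (last as) (hd bs)" using 1 by auto
      have y: "as = y # tl as" "tl as @ k # bs = z # zs" using * by (cases as; auto)+
      have "cusp_free ([x] @ y # tl as @ [k])"
        using * False 1 y by (subst cusp_free_append) (cases "tl as"; auto simp: cusp_free_def)
      then show ?thesis using * y
        by (intro exI[of _ "x # as"] exI[of _ k] exI[of _ bs]) (cases as; auto)
    qed
  qed auto
  from this[OF assms] obtain as k bs where *: "w # xs @ [w] = as @ k # bs" "as \<noteq> []" "bs \<noteq> []"
    "cusp_free (as @ [k])" "same k (last as) (hd bs)" by blast
  obtain ps where as: "as = w # ps" using * by (cases as) auto
  obtain rs where bs: "bs = rs @ [w]" using * as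
    by (cases bs rule: rev_cases) (auto simp flip: append_assoc append_Cons)
  have "xs = ps @ k # rs" using * as bs by auto
  with * as bs show ?thesis by (intro that) auto
qed

text \<open>
  A cycle through \<open>w\<close> with fewest cusps has the stated property at its first cusp \<open>k\<close>; the proof is
  by induction on the number of cusps. Suppose that a cusp-free path \<open>q\<close> leaves \<open>k\<close> by an edge of
  another colour and comes back to the segment from \<open>w\<close> to \<open>k\<close>, and let \<open>z\<close> be its first vertex on the
  whole cycle. Then \<open>q\<close> is a shortcut from \<open>k\<close> to \<open>z\<close>. Either the shortcut closes a cusp-free cycle
  with a segment of the given cycle, or it replaces a segment such that the number of cusps drops:
  the cusp at \<open>k\<close> disappears since \<open>q\<close> has another colour there, and at most one cusp arises, at
  \<open>z\<close>. The first edge of the cycle is kept, so that the way in which \<open>w\<close> is left can be prescribed.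
\<close>
lemma cusp_escape:
  assumes acyclic: "\<And>c. \<not> cusp_free_cycle c"
    and unswitched: "\<And>a b. same w a b \<Longrightarrow> a = b"
    and cyc: "successively adj (w # xs @ [w])" "distinct (w # xs)" "2 \<le> length xs"
  shows "\<exists>ps k u'. cusp_free (w # ps @ [k]) \<and> distinct (w # ps @ [k]) \<and> hd (ps @ [k]) = hd xs \<and>
      u' \<noteq> last (w # ps) \<and> adj k u' \<and> same k (last (w # ps)) u' \<and>
      (\<forall>q. cusp_free (k # q) \<and> distinct (k # q) \<and> q \<noteq> [] \<and> \<not> same k (last (w # ps)) (hd q) \<longrightarrow>
         set (w # ps) \<inter> set q = {})"
  using cyc
proof (induction "cusps (w # xs @ [w])" arbitrary: xs rule: less_induct)
  case less
  have xs2: "xs = hd xs # tl xs" "tl xs \<noteq> []" "last xs = last (tl xs)"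
    using less.prems(3) by (cases xs; cases "tl xs"; auto)+
  have "last xs \<in> set (tl xs)" "hd xs \<notin> set (tl xs)"
    using xs2 less.prems(2) by (metis last_in_set, metis distinct.simps(2))
  then have "\<not> same w (last xs) (hd xs)" using unswitched by metis
  then have "cusps (w # xs @ [w]) \<noteq> 0"
    using acyclic[of "w # xs"] less.prems by (auto simp: cusp_free_cycle_Cons cusp_free_def)
  then obtain ps k rs where xs: "xs = ps @ k # rs" and p: "cusp_free (w # ps @ [k])"
    and cusp: "same k (last (w # ps)) (hd (rs @ [w]))"
    using first_cusp less.prems(1) by metis
  define u where "u = last (w # ps)"
  define u' where "u' = hd (rs @ [w])"
  have d: "distinct (w # ps @ k # rs)" using less.prems xs by simp
  have cusp': "same k u u'" using cusp u_def u'_def by simp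
  have adjk: "adj k u'" using less.prems(1) xs unfolding u'_def
    by (cases rs) (auto simp: successively_append_iff successively_Cons)
  have uu': "u \<noteq> u'"
  proof
    assume "u = u'"
    then have "last (w # ps) = hd (rs @ [w])" by (simp add: u_def u'_def)
    then have "ps = []" "rs = []" using d
      by (cases ps rule: rev_cases; cases rs; auto)+
    then show False using less.prems(3) xs by simp
  qed
  have split0: "cusps (w # xs @ [w]) = 1 + cusps (k # rs @ [w])"
    using cusps_append[of "w # ps" k "rs @ [w]"] p cusp xs by (auto simp: cusp_free_def)
  have adjrs: "successively adj (k # rs @ [w])"
    using less.prems(1) successively_adj_append[of "w # ps" k "rs @ [w]"] xs by simp
  show ?case
  proof (cases "\<exists>q. cusp_free (k # q) \<and> distinct (k # q) \<and> q \<noteq> [] \<and> \<not> same k u (hd q) \<and>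
      set (w # ps) \<inter> set q \<noteq> {}")
    case False
    then show ?thesis using p d xs adjk uu' cusp' u_def
      by (intro exI[of _ ps] exI[of _ k] exI[of _ u']) (auto simp: hd_append)
  next
    case True
    then obtain q where q: "cusp_free (k # q)" "distinct (k # q)" "\<not> same k u (hd q)"
      "set (w # ps) \<inter> set q \<noteq> {}" by blast
    then have ex: "\<exists>z\<in>set q. z \<in> set (w # ps) \<union> set rs" by auto
    obtain q1 z q2 where qs: "q = q1 @ z # q2" and z: "z \<in> set (w # ps) \<union> set rs"
      and q1: "\<forall>y\<in>set q1. y \<notin> set (w # ps) \<union> set rs"
      using split_list_first_prop[OF ex] by auto
    have f1: "cusp_free (k # q1 @ [z])" using q(1) cusp_free_append[of "k # q1" z q2] qs by simp
    have f1r: "cusp_free (z # rev q1 @ [k])" using f1 cusp_free_rev[of "k # q1 @ [z]"] by simp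
    have s1: "\<not> same k u (hd (q1 @ [z]))" using q(3) qs by (cases q1) auto
    then have s1': "\<not> same k u' (hd (q1 @ [z]))" using cusp' same_trans by blast
    have d1: "distinct (k # q1 @ [z])" using q(2) qs by auto
    have dq: "set q1 \<inter> (set (w # ps) \<union> set rs) = {}" using q1 by blast
    have hq: "hd q1 = u \<Longrightarrow> q1 = []" using s1 same_refl by (cases q1) auto
    (* In the first case the segment from w to k and q form a cusp-free cycle. In the second case
       the segment from z to k is traversed by q backwards instead, in the third case the segment
       from k to z by q. *)
    consider (w) "z = w" | (p) "z \<in> set ps" | (r) "z \<in> set rs" using z by auto
    then show ?thesis
    proof cases
      case w
      have "cusp_free ((w # ps) @ k # (q1 @ [w]))"
        using p f1 s1 w u_def by (subst cusp_free_append) auto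
      moreover have dd: "distinct (w # ps @ k # q1)" using d d1 dq by auto
      moreover have l: "2 \<le> length (ps @ k # q1)"
      proof (rule ccontr)
        assume "\<not> ?thesis"
        then have "ps = [] \<and> q1 = []" by (cases ps; cases q1) auto
        then show False using s1 w u_def same_refl by simp
      qed
      moreover have "\<not> same w (last (ps @ k # q1)) (hd (ps @ k # q1))"
      proof
        assume "same w (last (ps @ k # q1)) (hd (ps @ k # q1))"
        then have eq: "last (ps @ k # q1) = hd (ps @ k # q1)" using unswitched by blast
        show False
        proof (cases ps)
          case Nil
          then show False using eq dd l by (cases q1 rule: rev_cases) auto
        next
          case (Cons a list)
          then have "last (k # q1) = a" using eq by simp
          then have "a \<in> set (k # q1)" by (metis last_in_set list.discI)
          then show False using Cons dd by auto
        qed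
      qed
      ultimately have "cusp_free_cycle (w # ps @ k # q1)" by (simp add: cusp_free_cycle_Cons)
      then show ?thesis using acyclic by blast
    next
      case p
      then obtain ps1 ps2 where ps: "ps = ps1 @ z # ps2" by (meson split_list)
      have fz: "cusp_free (w # ps1 @ [z])" "cusp_free (z # ps2 @ [k])"
        "\<not> same z (last (w # ps1)) (hd (ps2 @ [k]))"
        using \<open>cusp_free (w # ps @ [k])\<close> cusp_free_append[of "w # ps1" z "ps2 @ [k]"] ps by auto
      have u: "u = last (z # ps2)" using u_def ps by simp
      have fc: "cusp_free ((z # ps2) @ k # (q1 @ [z]))"
        using fz f1 s1 u by (subst cusp_free_append) auto
      have dc: "distinct (z # ps2 @ k # q1)" using d d1 dq ps by auto
      have lc: "2 \<le> length (ps2 @ k # q1)"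
      proof (rule ccontr)
        assume "\<not> ?thesis"
        then have "ps2 = [] \<and> q1 = []" by (cases ps2; cases q1) auto
        then show False using s1 u same_refl by simp
      qed
      have "\<not> cusp_free_cycle (z # ps2 @ k # q1)" using acyclic .
      then have "same z (last (ps2 @ k # q1)) (hd (ps2 @ k # q1))"
        using fc dc lc by (simp add: cusp_free_cycle_Cons)
      (* q and the segment from z to k form a cycle, which can only have its cusp at z. So q and the
         edge of the segment have the same colour at z, and the edge that comes from w another. *)
      then have cz: "same z (last (k # q1)) (hd (ps2 @ [k]))" by (cases ps2) auto
      then have "\<not> same z (last (w # ps1)) (last (k # q1))" using fz(3) same_trans by blast
      then have nz: "\<not> same z (last (w # ps1)) (hd (rev q1 @ [k]))"
        by (cases q1 rule: rev_cases) auto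
      have lq: "last (z # rev q1) = hd (q1 @ [z])" by (cases q1) auto
      define ys where "ys = ps1 @ z # rev q1 @ k # rs"
      have fk: "cusp_free (w # ps1 @ z # rev q1 @ [k])"
        using cusp_free_append[of "w # ps1" z "rev q1 @ [k]"] fz nz f1r by simp
      have "cusps (w # ys @ [w]) = cusps (k # rs @ [w])"
        using cusps_append[of "w # ps1 @ z # rev q1" k "rs @ [w]"] fk s1' same_sym[of k "hd (q1 @ [z])" u'] lq
        unfolding ys_def u'_def by (auto simp: cusp_free_def)
      then have less1: "cusps (w # ys @ [w]) < cusps (w # xs @ [w])" using split0 by simp
      have "successively adj (w # ys @ [w])"
        using successively_adj_append[of "w # ps1 @ z # rev q1" k "rs @ [w]"] fk adjrs
        unfolding ys_def by (simp add: cusp_free_def)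
      moreover have "distinct (w # ys)" using d d1 dq ps unfolding ys_def by auto
      moreover have "2 \<le> length ys" unfolding ys_def by simp
      moreover have "hd ys = hd xs" unfolding ys_def xs ps by (cases ps1) auto
      ultimately show ?thesis using less.hyps[OF less1] by simp
    next
      case r
      then obtain rs1 rs2 where rs: "rs = rs1 @ z # rs2" by (meson split_list)
      define ys where "ys = ps @ k # q1 @ z # rs2"
      have fk: "cusp_free (w # ps @ k # q1 @ [z])"
        using cusp_free_append[of "w # ps" k "q1 @ [z]"] p f1 s1 u_def by simp
      have adjz: "successively adj (k # rs1 @ [z])" "successively adj (z # rs2 @ [w])"
        using successively_adj_append[of "k # rs1" z "rs2 @ [w]"] adjrs rs by auto
      have u': "u' = hd (rs1 @ [z])" using u'_def rs by (cases rs1) auto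
      have c1: "cusps (w # ys @ [w]) = cusps (z # rs2 @ [w]) +
          (if same z (last (k # q1)) (hd (rs2 @ [w])) then 1 else 0)"
        using cusps_append[of "w # ps @ k # q1" z "rs2 @ [w]"] fk unfolding ys_def
        by (simp add: cusp_free_def)
      have c2: "cusps (w # xs @ [w]) = 1 + cusps (k # rs1 @ [z]) + cusps (z # rs2 @ [w]) +
          (if same z (last (k # rs1)) (hd (rs2 @ [w])) then 1 else 0)"
        using split0 cusps_append[of "k # rs1" z "rs2 @ [w]"] rs by simp
      have less1: "cusps (w # ys @ [w]) < cusps (w # xs @ [w])"
      proof (rule ccontr)
        assume "\<not> ?thesis"
        (* A number of cusps that does not drop leaves no cusp between k and z, nor one at z on the
           given cycle, but one at z on the new cycle. Then q and the segment between k and z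
           form a cusp-free cycle. *)
        then have cz: "same z (last (k # q1)) (hd (rs2 @ [w]))"
          "\<not> same z (last (k # rs1)) (hd (rs2 @ [w]))" "cusps (k # rs1 @ [z]) = 0"
          using c1 c2 by (auto split: if_splits)
        have nz: "\<not> same z (last (k # rs1)) (last (k # q1))" using cz same_trans by blast
        then have nz': "\<not> same z (last (k # rs1)) (hd (rev q1 @ [k]))"
          by (cases q1 rule: rev_cases) auto
        have "cusp_free ((k # rs1) @ z # (rev q1 @ [k]))"
          using cz adjz nz' f1r by (subst cusp_free_append) (auto simp: cusp_free_def)
        moreover have "distinct (k # rs1 @ z # rev q1)" using d d1 dq rs by auto
        moreover have "2 \<le> length (rs1 @ z # rev q1)"
        proof (rule ccontr)
          assume "\<not> ?thesis"
          then have "rs1 = [] \<and> q1 = []" by (cases rs1; cases q1) auto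
          then show False using s1' u' same_refl by simp
        qed
        moreover have "\<not> same k (last (rs1 @ z # rev q1)) (hd (rs1 @ z # rev q1))"
        proof -
          have "last (rs1 @ z # rev q1) = hd (q1 @ [z])" by (cases q1) auto
          moreover have "hd (rs1 @ z # rev q1) = u'" using u' by (cases rs1) auto
          ultimately show ?thesis using s1' same_sym by metis
        qed
        ultimately have "cusp_free_cycle (k # rs1 @ z # rev q1)" by (simp add: cusp_free_cycle_Cons)
        then show False using acyclic by blast
      qed
      have "successively adj (w # ys @ [w])"
        using successively_adj_append[of "w # ps @ k # q1" z "rs2 @ [w]"] fk adjz
        unfolding ys_def by (simp add: cusp_free_def)
      moreover have "distinct (w # ys)" using d d1 dq rs unfolding ys_def by auto
      moreover have "2 \<le> length ys" unfolding ys_def by simp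
      moreover have "hd ys = hd xs" unfolding ys_def xs by (cases ps) auto
      ultimately show ?thesis using less.hyps[OF less1] by simp
    qed
  qed
qed

text \<open>
  The edges of \<open>ds\<close> are alone in their colour at the vertices where they leave towards \<open>w\<close>. A path
  from \<open>w\<close> that first meets \<open>ds\<close> at \<open>z\<close> can therefore not arrive there in the colour of the edge
  towards \<open>w\<close>, except along that edge, and closes a cusp-free cycle with the segment of \<open>ds\<close>
  between \<open>z\<close> and \<open>w\<close>.
\<close>
lemma forced_path_avoided:
  assumes acyclic: "\<And>c. \<not> cusp_free_cycle c"
    and unswitched: "\<And>a b. same w a b \<Longrightarrow> a = b"
    and d: "cusp_free (ds @ [w])" "distinct (ds @ [w])" "ds \<noteq> []"
    and forced: "\<And>d1 z d2 y. ds = d1 @ z # d2 \<Longrightarrow> same z (hd (d2 @ [w])) y \<Longrightarrow> y = hd (d2 @ [w])"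
    and q: "cusp_free (w # q)" "distinct (w # q)" "q \<noteq> []" "hd q \<noteq> last ds"
  shows "set ds \<inter> set q = {}"
proof (rule ccontr)
  assume "\<not> ?thesis"
  then have ex: "\<exists>z\<in>set q. z \<in> set ds" by auto
  obtain q1 z q2 where qs: "q = q1 @ z # q2" and z: "z \<in> set ds"
    and q1: "\<forall>y\<in>set q1. y \<notin> set ds"
    using split_list_first_prop[OF ex] by auto
  obtain d1 d2 where ds: "ds = d1 @ z # d2" using z by (meson split_list)
  have f1: "cusp_free (w # q1 @ [z])" using q(1) cusp_free_append[of "w # q1" z q2] qs by simp
  have f2: "cusp_free (z # d2 @ [w])" using d(1) ds cusp_free_append[of d1 z "d2 @ [w]"] by simp
  have last_d: "last ds = last (z # d2)" using ds by simp
  have hd_q: "hd q = hd (q1 @ [z])" using qs by (cases q1) auto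
  have nz: "\<not> same z (last (w # q1)) (hd (d2 @ [w]))"
  proof
    assume "same z (last (w # q1)) (hd (d2 @ [w]))"
    then have eq: "last (w # q1) = hd (d2 @ [w])" using forced[OF ds] same_sym by metis
    show False
    proof (cases "q1 = []")
      case True
      then have "w = hd (d2 @ [w])" using eq by simp
      then have "d2 = []" using d(2) ds by (cases d2) auto
      then show False using q(4) last_d hd_q True by simp
    next
      case False
      then have *: "hd (d2 @ [w]) \<in> set q1" using eq by (metis last.simps last_in_set)
      then show False
      proof (cases d2)
        case Nil
        then show False using * q(2) qs by auto
      next
        case (Cons a list)
        then show False using * q1 ds by auto
      qed
    qed
  qed
  have "cusp_free ((w # q1) @ z # (d2 @ [w]))"
    using f1 f2 nz by (subst cusp_free_append) auto
  moreover have "distinct (w # q1 @ z # d2)" using q(2) qs d(2) ds q1 by auto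
  moreover have "2 \<le> length (q1 @ z # d2)"
  proof (rule ccontr)
    assume "\<not> ?thesis"
    then have "q1 = [] \<and> d2 = []" by (cases q1; cases d2) auto
    then show False using q(4) last_d hd_q by simp
  qed
  moreover have "\<not> same w (last (q1 @ z # d2)) (hd (q1 @ z # d2))"
  proof
    assume "same w (last (q1 @ z # d2)) (hd (q1 @ z # d2))"
    then have "last (q1 @ z # d2) = hd (q1 @ z # d2)" using unswitched by blast
    moreover have "hd (q1 @ z # d2) = hd q" unfolding hd_q by (cases q1) auto
    ultimately show False using q(4) last_d by simp
  qed
  ultimately have "cusp_free_cycle (w # q1 @ z # d2)" by (simp add: cusp_free_cycle_Cons)
  then show False using acyclic by blast
qed

text \<open>
  The assumption \<open>descend\<close> replaces the structure of a forest: from each possible cusp \<open>k\<close> a path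
  of the kind of \<open>forced_path_avoided\<close> leads to a vertex of \<open>W\<close>.
\<close>
lemma splitting_vertex:
  assumes acyclic: "\<And>c. \<not> cusp_free_cycle c"
    and fin: "finite {v. \<exists>u. adj v u}"
    and W: "W \<noteq> {}"
    and unswitched: "\<And>w a b. w \<in> W \<Longrightarrow> same w a b \<Longrightarrow> a = b"
    and descend: "\<And>k a b. same k a b \<Longrightarrow> a \<noteq> b \<Longrightarrow> adj k a \<Longrightarrow> adj k b \<Longrightarrow>
      \<exists>ds w. w \<in> W \<and> cusp_free (k # ds @ [w]) \<and> distinct (k # ds @ [w]) \<and> \<not> same k a (hd (ds @ [w])) \<and>
        (\<forall>d1 z d2 y. k # ds = d1 @ z # d2 \<longrightarrow> same z (hd (d2 @ [w])) y \<longrightarrow> y = hd (d2 @ [w]))"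
  shows "\<exists>w\<in>W. \<nexists>xs. successively adj (w # xs @ [w]) \<and> distinct (w # xs) \<and> 2 \<le> length xs"
proof (rule ccontr)
  assume "\<not> ?thesis"
  then have cyc: "\<exists>xs. successively adj (w # xs @ [w]) \<and> distinct (w # xs) \<and> 2 \<le> length xs"
    if "w \<in> W" for w using that by blast
  (* For w and b with the smallest Q w b, the vertex w' at the end of the descent from the first
     cusp, with b' the vertex before it, gives a smaller set still. *)
  define Q where "Q w b = {x. \<exists>q. cusp_free (w # q) \<and> distinct (w # q) \<and> (q = [] \<or> hd q \<noteq> b) \<and> x \<in> set (w # q)}"
    for w b
  have finQ: "finite (Q w b)" for w b
  proof (rule finite_subset)
    show "Q w b \<subseteq> insert w {v. \<exists>u. adj v u}"
    proof
      fix x assume "x \<in> Q w b"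
      then obtain q where q: "cusp_free (w # q)" "x \<in> set (w # q)" unfolding Q_def by blast
      show "x \<in> insert w {v. \<exists>u. adj v u}"
      proof (cases "x = w")
        case False
        then obtain as bs where "q = as @ x # bs" using q by (auto dest: split_list)
        then have "adj (last (w # as)) x" using q(1)
          by (cases as rule: rev_cases) (auto simp: cusp_free_def successively_append_iff successively_Cons)
        then show ?thesis using adj_sym by blast
      qed simp
    qed
  qed (use fin in simp)
  obtain w b where w: "w \<in> W" and min: "\<And>w' b'. w' \<in> W \<Longrightarrow> card (Q w b) \<le> card (Q w' b')"
  proof -
    obtain w0 where "w0 \<in> W" using W by blast
    then have "\<exists>x. fst x \<in> W \<and> (\<forall>y. fst y \<in> W \<longrightarrow> card (Q (fst x) (snd x)) \<le> card (Q (fst y) (snd y)))"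
      by (intro ex_has_least_nat[of _ "(w0, w0)"]) simp
    then show ?thesis using that by (metis fst_conv snd_conv)
  qed
  obtain xs where xs: "successively adj (w # xs @ [w])" "distinct (w # xs)" "2 \<le> length xs" "hd xs \<noteq> b"
  proof -
    obtain xs where xs: "successively adj (w # xs @ [w])" "distinct (w # xs)" "2 \<le> length xs"
      using cyc w by blast
    (* A cycle can be traversed in both directions, and at most one of them starts with b. *)
    show ?thesis
    proof (cases "hd xs = b")
      case True
      have "last xs \<noteq> hd xs" using xs by (cases xs; cases "tl xs" rule: rev_cases) auto
      then have "hd (rev xs) \<noteq> b" using True xs(3) by (simp add: hd_rev)
      moreover have "successively adj (w # rev xs @ [w])"
        using xs(1) successively_adj_rev[of "w # xs @ [w]"] by simp
      ultimately show ?thesis using that[of "rev xs"] xs by simp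
    next
      case False
      then show ?thesis using that xs by blast
    qed
  qed
  obtain ps k u' where p: "cusp_free (w # ps @ [k])" "distinct (w # ps @ [k])" "hd (ps @ [k]) = hd xs"
    and u': "u' \<noteq> last (w # ps)" "adj k u'" "same k (last (w # ps)) u'"
    and escape: "\<And>q. cusp_free (k # q) \<Longrightarrow> distinct (k # q) \<Longrightarrow> q \<noteq> [] \<Longrightarrow> \<not> same k (last (w # ps)) (hd q) \<Longrightarrow>
         set (w # ps) \<inter> set q = {}"
    using cusp_escape[OF acyclic unswitched[OF w] xs(1-3)] by metis
  have "adj (last (w # ps)) k" using p(1)
    by (cases ps rule: rev_cases) (auto simp: cusp_free_def successively_append_iff successively_Cons)
  then have "adj k (last (w # ps))" using adj_sym by blast
  then obtain ds w' where w': "w' \<in> W" and ds: "cusp_free (k # ds @ [w'])" "distinct (k # ds @ [w'])"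
    "\<not> same k (last (w # ps)) (hd (ds @ [w']))"
    and forced: "\<And>d1 z d2 y. k # ds = d1 @ z # d2 \<Longrightarrow> same z (hd (d2 @ [w'])) y \<Longrightarrow> y = hd (d2 @ [w'])"
    using descend[OF u'(3)] u' by metis
  define b' where "b' = last (k # ds)"
  have extend: "cusp_free (w # ps @ k # ds @ w' # q) \<and> distinct (w # ps @ k # ds @ w' # q)"
    if q: "cusp_free (w' # q)" "distinct (w' # q)" "q = [] \<or> hd q \<noteq> b'" for q
  proof -
    have dis: "set (k # ds) \<inter> set q = {}"
    proof (cases "q = []")
      case False
      have 1: "cusp_free ((k # ds) @ [w'])" "distinct ((k # ds) @ [w'])" "k # ds \<noteq> []" using ds by simp_all
      show ?thesis
        using forced_path_avoided[OF acyclic unswitched[OF w'] 1 forced q(1,2) False] q(3) False b'_def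
        by simp
    qed simp
    have fk: "cusp_free ((k # ds) @ w' # q)"
    proof (subst cusp_free_append, intro conjI impI)
      assume "k # ds \<noteq> [] \<and> q \<noteq> []"
      then show "\<not> same w' (last (k # ds)) (hd q)" using q(3) unswitched[OF w'] b'_def by metis
    qed (use ds q in auto)
    have dk: "distinct (k # ds @ w' # q)" using dis ds q by auto
    have hdk: "hd (ds @ w' # q) = hd (ds @ [w'])" by (cases ds) auto
    have "set (w # ps) \<inter> set (ds @ w' # q) = {}"
      using escape[of "ds @ w' # q"] fk dk ds(3) hdk by simp
    moreover have "cusp_free ((w # ps) @ k # (ds @ w' # q))"
      using p fk ds(3) hdk by (subst cusp_free_append) auto
    ultimately show ?thesis using p dk by auto
  qed
  have "Q w' b' \<subset> Q w b"
  proof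
    show "Q w' b' \<subseteq> Q w b"
    proof
      fix x assume "x \<in> Q w' b'"
      then obtain q where q: "cusp_free (w' # q)" "distinct (w' # q)" "q = [] \<or> hd q \<noteq> b'" "x \<in> set (w' # q)"
        unfolding Q_def by blast
      have "hd (ps @ k # ds @ w' # q) \<noteq> b" using p(3) xs(4) by (cases ps) auto
      then show "x \<in> Q w b" unfolding Q_def using extend[OF q(1-3)] q(4)
        by (intro CollectI exI[of _ "ps @ k # ds @ w' # q"]) auto
    qed
    have "w \<notin> Q w' b'" unfolding Q_def using extend by fastforce
    moreover have "w \<in> Q w b" unfolding Q_def
      by (intro CollectI exI[of _ "[]"]) (simp add: cusp_free_def)
    ultimately show "Q w' b' \<noteq> Q w b" by blast
  qed
  then have "card (Q w' b') < card (Q w b)" using finQ psubset_card_mono by blast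
  then show False using min[OF w', of b'] by simp
qed

end

section \<open>The graph of a forest\<close>

definition linked :: "('a, 'x) forest \<Rightarrow> ('a, 'x) node \<Rightarrow> ('a, 'x) node \<Rightarrow> bool" where
  "linked F u v \<longleftrightarrow> (u, v) \<in> edges F \<or> (v, u) \<in> edges F"

definition same_class ::
  "('a, 'x) forest \<Rightarrow> ('a, 'x) node \<Rightarrow> ('a, 'x) node \<Rightarrow> ('a, 'x) node \<Rightarrow> bool" where
  "same_class F v a b \<longleftrightarrow> a = b \<or> switched F v \<and> a \<in> successors F v \<and> b \<in> successors F v"

lemma child_cases:
  "child (TreeS One) s v \<longleftrightarrow> False"
  "child (TreeS (Disj t t')) s v \<longleftrightarrow> s = LeftS \<and> v = TreeS t \<or> s = RightS \<and> v = TreeS t'"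
  "child (TreeS (OrL t)) s v \<longleftrightarrow> s = LeftS \<and> v = TreeS t \<or> s = RightS \<and> v = Star"
  "child (TreeS (OrR t)) s v \<longleftrightarrow> s = LeftS \<and> v = Star \<or> s = RightS \<and> v = TreeS t"
  "child (TreeS (Exp M)) s v \<longleftrightarrow> (\<exists>w k. k < count M w \<and> s = SummandS w k \<and> v = WitS w)"
  "child (WitS (Wire x)) s v \<longleftrightarrow> False"
  "child (WitS (Tensor t t')) s v \<longleftrightarrow> s = LeftS \<and> v = TreeS t \<or> s = RightS \<and> v = TreeS t'"
  "child Star s v \<longleftrightarrow> False"
  by (auto simp: child.simps)

lemma child_unique: "child u s v \<Longrightarrow> child u s v' \<Longrightarrow> v = v'"
  by (auto simp: child.simps)

lemma occurs_Root_iff: "occurs F (Root m k) u \<longleftrightarrow> k < count F m \<and> u = member_subterm m"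
  by (subst occurs.simps) auto

lemma occurs_Succ_iff: "occurs F (Succ n s) v \<longleftrightarrow> (\<exists>u. occurs F n u \<and> child u s v)"
  by (subst occurs.simps) auto

lemma occurs_unique: "occurs F n u \<Longrightarrow> occurs F n v \<Longrightarrow> u = v"
proof (induction n arbitrary: u v)
  case (Root m k)
  then show ?case by (simp add: occurs_Root_iff)
next
  case (Succ n s)
  then show ?case by (metis occurs_Succ_iff child_unique)
qed

lemma occurs_nodes: "occurs F n u \<Longrightarrow> n \<in> nodes F"
  by (auto simp: nodes_def)

lemma Succ_in_nodes_iff: "Succ n s \<in> nodes F \<longleftrightarrow> (\<exists>u v. occurs F n u \<and> child u s v)"
  unfolding nodes_def mem_Collect_eq occurs_Succ_iff by blast

lemma successors_iff:
  "m \<in> successors F n \<longleftrightarrow> (\<exists>u s v. m = Succ n s \<and> occurs F n u \<and> child u s v)"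
  unfolding successors_def mem_Collect_eq Succ_in_nodes_iff by blast

lemma successors_of:
  assumes "occurs F n u"
  shows "successors F n = {Succ n s | s v. child u s v}"
proof (intro set_eqI iffI)
  fix m assume "m \<in> successors F n"
  then obtain u' s v where "m = Succ n s" "occurs F n u'" "child u' s v"
    unfolding successors_iff by blast
  then show "m \<in> {Succ n s | s v. child u s v}" using occurs_unique[OF assms] by blast
next
  fix m assume "m \<in> {Succ n s | s v. child u s v}"
  then show "m \<in> successors F n" unfolding successors_iff using assms by blast
qed

lemma successors_nodes: "m \<in> successors F n \<Longrightarrow> m \<in> nodes F \<and> n \<in> nodes F"
proof -
  assume "m \<in> successors F n"
  then obtain u s v where "m = Succ n s" "occurs F n u" "child u s v"
    unfolding successors_iff by blast
  then show ?thesis using Succ_in_nodes_iff occurs_nodes by blast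
qed

definition axiom_link :: "('a, 'x) forest \<Rightarrow> ('a, 'x) node \<Rightarrow> ('a, 'x) node \<Rightarrow> bool" where
  "axiom_link F u v \<longleftrightarrow>
     (\<exists>x. occurs F u (WitS (Wire (PosW x))) \<and> occurs F v (WitS (Wire (NegW x))))"

lemma edges_iff: "(u, v) \<in> edges F \<longleftrightarrow> u \<in> successors F v \<or> axiom_link F u v"
  by (auto simp: edges_def axiom_link_def dest: successors_nodes)

lemma linked_iff:
  "linked F u v \<longleftrightarrow> u \<in> successors F v \<or> v \<in> successors F u \<or> axiom_link F u v \<or> axiom_link F v u"
  by (auto simp: linked_def edges_iff)

lemma linked_sym: "linked F u v \<Longrightarrow> linked F v u"
  by (auto simp: linked_def)

lemma linked_nodes: "linked F u v \<Longrightarrow> u \<in> nodes F \<and> v \<in> nodes F"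
  by (auto simp: linked_iff axiom_link_def dest: successors_nodes occurs_nodes)

lemma axiom_link_no_successors:
  assumes "axiom_link F u v \<or> axiom_link F v u"
  shows "successors F u = {}" "\<not> switched F u"
proof -
  obtain w where w: "occurs F u (WitS (Wire w))" using assms by (auto simp: axiom_link_def)
  show "successors F u = {}" using successors_of[OF w] by (auto simp: child_cases)
  show "\<not> switched F u" using occurs_unique[OF w] by (auto simp: switched_def)
qed

lemma switched_iff:
  "occurs F n u \<Longrightarrow> switched F n \<longleftrightarrow> (\<exists>M. u = TreeS (Exp M)) \<or> (\<exists>t s. u = TreeS (Disj t s))"
  unfolding switched_def using occurs_unique by metis

lemma size_Succ: "size (Succ n s) > size n"
  by simp

lemma successors_asym: "u \<in> successors F v \<Longrightarrow> v \<notin> successors F u"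
proof
  assume "u \<in> successors F v" "v \<in> successors F u"
  then obtain s s' where "u = Succ v s" "v = Succ u s'" by (auto simp: successors_iff)
  then have "size u > size v" "size v > size u" using size_Succ by metis+
  then show False by simp
qed

text \<open>
  Paths and cycles are considered within a set \<open>R\<close> of nodes, so that deleting nodes from the graph
  means passing to a smaller set.
\<close>
definition linked_in ::
  "('a, 'x) forest \<Rightarrow> ('a, 'x) node set \<Rightarrow> ('a, 'x) node \<Rightarrow> ('a, 'x) node \<Rightarrow> bool" where
  "linked_in F R u v \<longleftrightarrow> u \<in> R \<and> v \<in> R \<and> linked F u v"

interpretation region: locally_coloured_graph "linked_in F R" "same_class F" for F R
  by unfold_locales (auto simp: linked_in_def same_class_def intro: linked_sym)

definition acyclic_on :: "('a, 'x) forest \<Rightarrow> ('a, 'x) node set \<Rightarrow> bool" where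
  "acyclic_on F R \<longleftrightarrow> (\<forall>c. \<not> region.cusp_free_cycle F R c)"

lemma cusp_free_cycle_iff:
  "region.cusp_free_cycle F R xs \<longleftrightarrow> 3 \<le> length xs \<and> distinct xs \<and> set xs \<subseteq> R \<and>
     (\<forall>i < length xs. linked F (xs ! i) (xs ! (Suc i mod length xs)) \<and>
        \<not> same_class F (xs ! (Suc i mod length xs)) (xs ! i) (xs ! (Suc (Suc i) mod length xs)))"
proof (cases "3 \<le> length xs")
  case True
  have mod: "Suc i mod length xs < length xs" for i
    by (rule mod_less_divisor) (use True in linarith)
  have "(\<forall>i < length xs. xs ! i \<in> R \<and> xs ! (Suc i mod length xs) \<in> R) \<longleftrightarrow> set xs \<subseteq> R"
    using mod by (metis in_set_conv_nth nth_mem subset_code(1))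
  then show ?thesis
    unfolding region.cusp_free_cycle_iff_nth linked_in_def by blast
qed (simp add: region.cusp_free_cycle_iff_nth)

lemma acyclic_on_mono: "acyclic_on F R \<Longrightarrow> R' \<subseteq> R \<Longrightarrow> acyclic_on F R'"
  unfolding acyclic_on_def cusp_free_cycle_iff by blast

section \<open>AC-correctness as the absence of cusp-free cycles\<close>

lemma switching_graph_edge:
  assumes "{a, b} \<in> switching_graph F \<sigma>"
  shows "linked F a b" "switched F b \<Longrightarrow> a \<in> successors F b \<Longrightarrow> a = \<sigma> b"
proof -
  obtain m n where e: "(m, n) \<in> edges F" "\<not> (switched F n \<and> m \<in> successors F n \<and> m \<noteq> \<sigma> n)"
    and ab: "a = m \<and> b = n \<or> a = n \<and> b = m"
  proof -
    obtain e where e: "e \<in> edges F - {(m, n). switched F n \<and> m \<in> successors F n \<and> m \<noteq> \<sigma> n}"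
      "{a, b} = (\<lambda>(m, n). {m, n}) e"
      using assms unfolding switching_graph_def by (rule imageE)
    obtain m n where "e = (m, n)" by (cases e)
    with e show ?thesis using that[of m n] by (simp add: doubleton_eq_iff)
  qed
  show "linked F a b" using ab e by (auto simp: linked_def)
  assume sw: "switched F b" "a \<in> successors F b"
  show "a = \<sigma> b" using ab
  proof
    assume "a = m \<and> b = n"
    then show ?thesis using e sw by auto
  next
    assume ab: "a = n \<and> b = m"
    then have "m \<in> successors F n \<or> axiom_link F m n" using e edges_iff by metis
    then show ?thesis using ab sw successors_asym[of b F a] axiom_link_no_successors[of F b a] by auto
  qed
qed

text \<open>
  At a switched node only one successor edge survives a switching, so that a cycle of a switching graph
  never uses two of them.
\<close>
lemma AC_correct_if_acyclic:
  assumes "acyclic_on F (nodes F)"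
  shows "AC_correct F"
  unfolding AC_correct_def acyclic_graph_def
proof (intro allI impI notI, elim exE)
  fix \<sigma> vs assume "is_cycle (switching_graph F \<sigma>) vs"
  then have vs: "3 \<le> length vs" "distinct vs"
    and e: "\<And>i. i < length vs \<Longrightarrow> {vs ! i, vs ! (Suc i mod length vs)} \<in> switching_graph F \<sigma>"
    unfolding is_cycle_def by blast+
  let ?n = "length vs"
  have "\<not> same_class F (vs ! (Suc i mod ?n)) (vs ! i) (vs ! (Suc (Suc i) mod ?n))" if i: "i < ?n" for i
  proof
    assume s: "same_class F (vs ! (Suc i mod ?n)) (vs ! i) (vs ! (Suc (Suc i) mod ?n))"
    have "i \<noteq> Suc (Suc i) mod ?n" using vs(1) i by (auto simp: mod_Suc split: if_splits)
    moreover have "Suc (Suc i) mod ?n < ?n" by (rule mod_less_divisor) (use i in linarith)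
    ultimately have ne: "vs ! i \<noteq> vs ! (Suc (Suc i) mod ?n)"
      using vs(2) i nth_eq_iff_index_eq by metis
    have "Suc i mod ?n < ?n" by (rule mod_less_divisor) (use i in linarith)
    from e[OF this] have e2: "{vs ! (Suc (Suc i) mod ?n), vs ! (Suc i mod ?n)} \<in> switching_graph F \<sigma>"
      by (simp add: mod_Suc_eq insert_commute)
    show False
      using s ne switching_graph_edge(2)[OF e[OF i]] switching_graph_edge(2)[OF e2]
      by (auto simp: same_class_def)
  qed
  moreover have "linked F (vs ! i) (vs ! (Suc i mod ?n))" if "i < ?n" for i
    using switching_graph_edge(1)[OF e[OF that]] .
  moreover from this have "set vs \<subseteq> nodes F"
    by (metis in_set_conv_nth linked_nodes subsetI)
  ultimately have "region.cusp_free_cycle F (nodes F) vs"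
    using vs unfolding cusp_free_cycle_iff by blast
  then show False using assms by (auto simp: acyclic_on_def)
qed

text \<open>
  A cusp-free cycle uses at most one successor edge of each switched node. Some switching selects
  all these edges and keeps the cycle. It needs a value also at the switched nodes off the cycle, and
  an empty expansion would admit none.
\<close>
lemma acyclic_if_AC_correct:
  assumes AC: "AC_correct F"
    and nonempty: "\<And>n. switched F n \<Longrightarrow> successors F n \<noteq> {}"
  shows "acyclic_on F (nodes F)"
  unfolding acyclic_on_def
proof (intro allI notI)
  fix vs assume "region.cusp_free_cycle F (nodes F) vs"
  then have vs: "3 \<le> length vs" "distinct vs"
    and l: "\<And>i. i < length vs \<Longrightarrow> linked F (vs ! i) (vs ! (Suc i mod length vs))"
    and s: "\<And>i. i < length vs \<Longrightarrow>
      \<not> same_class F (vs ! (Suc i mod length vs)) (vs ! i) (vs ! (Suc (Suc i) mod length vs))"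
    unfolding cusp_free_cycle_iff by blast+
  let ?n = "length vs"
  define used where "used v m \<longleftrightarrow> (\<exists>i < ?n. {v, m} = {vs ! i, vs ! (Suc i mod ?n)})" for v m
  have used_cases: "\<exists>i < ?n. v = vs ! i \<and> m = vs ! (Suc i mod ?n) \<or> m = vs ! i \<and> v = vs ! (Suc i mod ?n)"
    if "used v m" for v m using that by (auto simp: used_def doubleton_eq_iff)
  have mod_less: "Suc i mod ?n < ?n" for i by (rule mod_less_divisor) (use vs in linarith)
  have unique: "m = m'" if u: "used v m" "used v m'" "same_class F v m m'" for v m m'
  proof -
    obtain i where i: "i < ?n" "v = vs ! i \<and> m = vs ! (Suc i mod ?n) \<or> m = vs ! i \<and> v = vs ! (Suc i mod ?n)"
      using used_cases[OF u(1)] by blast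
    obtain j where j: "j < ?n" "v = vs ! j \<and> m' = vs ! (Suc j mod ?n) \<or> m' = vs ! j \<and> v = vs ! (Suc j mod ?n)"
      using used_cases[OF u(2)] by blast
    have inj: "vs ! a = vs ! b \<Longrightarrow> a < ?n \<Longrightarrow> b < ?n \<Longrightarrow> a = b" for a b
      using vs(2) nth_eq_iff_index_eq by metis
    have no: "False" if "Suc a mod ?n = b" "a < ?n" "same_class F (vs ! b) (vs ! a) (vs ! (Suc b mod ?n))"
      for a b using s[OF that(2)] that(1,3) by (auto simp: mod_Suc_eq)
    from i(2) j(2) show ?thesis
    proof (elim disjE conjE)
      assume "v = vs ! i" "m = vs ! (Suc i mod ?n)" "v = vs ! j" "m' = vs ! (Suc j mod ?n)"
      then show ?thesis using inj i(1) j(1) by metis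
    next
      assume *: "v = vs ! i" "m = vs ! (Suc i mod ?n)" "m' = vs ! j" "v = vs ! (Suc j mod ?n)"
      then have "Suc j mod ?n = i" using inj i(1) mod_less by metis
      then show ?thesis using no[of j i] j(1) u(3) * region.same_sym by metis
    next
      assume *: "m = vs ! i" "v = vs ! (Suc i mod ?n)" "v = vs ! j" "m' = vs ! (Suc j mod ?n)"
      then have "Suc i mod ?n = j" using inj j(1) mod_less by metis
      then show ?thesis using no[of i j] i(1) u(3) * by metis
    next
      assume *: "m = vs ! i" "v = vs ! (Suc i mod ?n)" "m' = vs ! j" "v = vs ! (Suc j mod ?n)"
      then have "Suc i mod ?n = Suc j mod ?n" using inj mod_less by metis
      then have "i = j" using i(1) j(1) by (auto simp: mod_Suc split: if_splits)
      then show ?thesis using * by simp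
    qed
  qed
  (* The switching follows the cycle where the cycle uses a successor edge. *)
  define \<sigma> where "\<sigma> v = (if \<exists>m \<in> successors F v. used v m then SOME m. m \<in> successors F v \<and> used v m
      else SOME m. m \<in> successors F v)" for v
  have "switching F \<sigma>" unfolding switching_def
  proof (intro allI impI)
    fix v assume "switched F v"
    then have ex: "\<exists>m. m \<in> successors F v" using nonempty by blast
    show "\<sigma> v \<in> successors F v"
    proof (cases "\<exists>m \<in> successors F v. used v m")
      case True
      then have "\<exists>m. m \<in> successors F v \<and> used v m" by blast
      from someI_ex[OF this] True show ?thesis unfolding \<sigma>_def by simp
    next
      case False
      then show ?thesis unfolding \<sigma>_def using someI_ex[OF ex] by simp
    qed
  qed
  have kept: "m = \<sigma> v" if "m \<in> successors F v" "used v m" "switched F v" for m v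
  proof -
    have ex: "\<exists>m. m \<in> successors F v \<and> used v m" using that by blast
    then have "\<sigma> v = (SOME m. m \<in> successors F v \<and> used v m)" unfolding \<sigma>_def by auto
    with someI_ex[OF ex] have "\<sigma> v \<in> successors F v" "used v (\<sigma> v)" by auto
    then show ?thesis using unique that by (auto simp: same_class_def)
  qed
  have "{vs ! i, vs ! (Suc i mod ?n)} \<in> switching_graph F \<sigma>" if i: "i < ?n" for i
  proof -
    have used: "used (vs ! i) (vs ! (Suc i mod ?n))" "used (vs ! (Suc i mod ?n)) (vs ! i)"
      using i by (auto simp: used_def)
    have edge: "{a, b} \<in> switching_graph F \<sigma>" if "(a, b) \<in> edges F" "used b a" for a b
    proof -
      have "(a, b) \<in> edges F - {(m, n). switched F n \<and> m \<in> successors F n \<and> m \<noteq> \<sigma> n}"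
        using that kept[of a b] by blast
      from imageI[OF this, of "\<lambda>(m, n). {m, n}"] show ?thesis
        unfolding switching_graph_def by (simp only: case_prod_conv)
    qed
    from l[OF i, unfolded linked_def] show ?thesis
    proof
      assume "(vs ! i, vs ! (Suc i mod ?n)) \<in> edges F"
      from edge[OF this used(2)] show ?thesis .
    next
      assume "(vs ! (Suc i mod ?n), vs ! i) \<in> edges F"
      from edge[OF this used(1)] show ?thesis by (simp only: insert_commute)
    qed
  qed
  then have "is_cycle (switching_graph F \<sigma>) vs" using vs unfolding is_cycle_def by blast
  then show False using AC \<open>switching F \<sigma>\<close> unfolding AC_correct_def acyclic_graph_def by blast
qed

section \<open>Ancestors and descendants of nodes\<close>

primrec anc :: "('a, 'x) node \<Rightarrow> ('a, 'x) node set" where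
  "anc (Root m k) = {Root m k}"
| "anc (Succ n s) = insert (Succ n s) (anc n)"

lemma anc_refl: "n \<in> anc n"
  by (cases n) auto

lemma anc_size: "a \<in> anc b \<Longrightarrow> a = b \<or> size a < size b"
  by (induction b) auto

lemma anc_trans: "a \<in> anc b \<Longrightarrow> b \<in> anc c \<Longrightarrow> a \<in> anc c"
  by (induction c) auto

lemma anc_chain: "a \<in> anc c \<Longrightarrow> b \<in> anc c \<Longrightarrow> a \<in> anc b \<or> b \<in> anc a"
  by (induction c) (auto simp: anc_refl)

lemma Succ_not_anc: "Succ n s \<notin> anc n"
  using anc_size[of "Succ n s" n] by auto

lemma anc_nodes: "m \<in> nodes F \<Longrightarrow> a \<in> anc m \<Longrightarrow> a \<in> nodes F"
proof (induction m)
  case (Succ n s)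
  then have "n \<in> nodes F" by (auto simp: Succ_in_nodes_iff dest: occurs_nodes)
  then show ?case using Succ by auto
qed simp

lemma anc_step: "n \<in> anc m \<Longrightarrow> m \<noteq> n \<Longrightarrow> \<exists>s. Succ n s \<in> anc m"
proof (induction m)
  case (Succ m s)
  then show ?case using anc_refl by (cases "m = n") auto
qed simp

lemma successors_Succ: "m \<in> successors F n \<longleftrightarrow> (\<exists>s. m = Succ n s) \<and> m \<in> nodes F"
  by (auto simp: successors_def)

text \<open>
  Copies of the elements of a multiset, told apart by numbers below their multiplicities, form a set
  whose image under forgetting the numbers is the multiset. This is how both the members of a forest
  and the summands of an expansion become nodes.
\<close>
lemma image_mset_copies:
  assumes "\<And>w k w' k'. g w k = g w' k' \<Longrightarrow> w = w' \<and> k = k'"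
  shows "finite {g w k | w k. k < count M w} \<and>
    ((\<forall>w k. k < count M w \<longrightarrow> f (g w k) = w) \<longrightarrow>
      image_mset f (mset_set {g w k | w k. k < count M w}) = M)"
proof (induction M)
  case (add x M)
  let ?A = "{g w k | w k. k < count M w}"
  have ins: "{g w k | w k. k < count (add_mset x M) w} = insert (g x (count M x)) ?A"
    by (auto simp: less_Suc_eq split: if_splits)
  have notin: "g x (count M x) \<notin> ?A" using assms by fastforce
  show ?case
  proof (intro conjI impI)
    show "finite {g w k | w k. k < count (add_mset x M) w}" unfolding ins using add by simp
    assume f: "\<forall>w k. k < count (add_mset x M) w \<longrightarrow> f (g w k) = w"
    then have "image_mset f (mset_set ?A) = M" using add by (auto simp: less_Suc_eq)
    moreover have "f (g x (count M x)) = x" using f by simp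
    ultimately show "image_mset f (mset_set {g w k | w k. k < count (add_mset x M) w}) = add_mset x M"
      unfolding ins using add notin by simp
  qed
qed simp

lemma successors_Exp:
  assumes "occurs F n (TreeS (Exp M))"
  shows "successors F n = {Succ n (SummandS w k) | w k. k < count M w}"
  unfolding successors_of[OF assms] child_cases by blast

lemma finite_successors [simp]: "finite (successors F n)"
proof (cases "n \<in> nodes F")
  case True
  then obtain u where u: "occurs F n u" by (auto simp: nodes_def)
  show ?thesis
  proof (cases "\<exists>M. u = TreeS (Exp M)")
    case True
    then obtain M where M: "u = TreeS (Exp M)" by blast
    show ?thesis unfolding successors_Exp[OF u[unfolded M]]
      using image_mset_copies[of "\<lambda>w k. Succ n (SummandS w k)" M] by blast
  next
    case False
    then have "successors F n \<subseteq> {Succ n LeftS, Succ n RightS}"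
      unfolding successors_of[OF u] by (auto simp: child.simps)
    then show ?thesis by (meson finite.simps finite_subset)
  qed
next
  case False
  then have "successors F n = {}" using successors_nodes by blast
  then show ?thesis by simp
qed

definition below :: "('a, 'x) forest \<Rightarrow> ('a, 'x) node \<Rightarrow> ('a, 'x) node set" where
  "below F n = {m \<in> nodes F. n \<in> anc m}"

lemma below_unfold: "below F n \<subseteq> insert n (\<Union>c\<in>successors F n. below F c)"
proof
  fix m assume m: "m \<in> below F n"
  show "m \<in> insert n (\<Union>c\<in>successors F n. below F c)"
  proof (cases "m = n")
    case False
    then obtain s where s: "Succ n s \<in> anc m" using m anc_step by (auto simp: below_def)
    then have "Succ n s \<in> nodes F" using m anc_nodes by (auto simp: below_def)
    then have "Succ n s \<in> successors F n" by (auto simp: successors_Succ)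
    moreover have "m \<in> below F (Succ n s)" using m s by (auto simp: below_def)
    ultimately show ?thesis by blast
  qed simp
qed

lemma finite_below_if_children:
  assumes "\<And>s v. child u s v \<Longrightarrow> \<forall>n. occurs F n v \<longrightarrow> finite (below F n)"
  shows "\<forall>n. occurs F n u \<longrightarrow> finite (below F n)"
proof (intro allI impI)
  fix n assume n: "occurs F n u"
  have "finite (below F c)" if "c \<in> successors F n" for c
  proof -
    obtain s v where "c = Succ n s" "child u s v" using \<open>c \<in> _\<close> unfolding successors_of[OF n] by blast
    then show ?thesis using assms n occurs_Succ_iff by blast
  qed
  then have "finite (insert n (\<Union>c\<in>successors F n. below F c))" by (simp add: finite_successors)
  then show "finite (below F n)" by (rule finite_subset[OF below_unfold])
qed

lemma finite_below_subterm:
  fixes t :: "'x tree" and w :: "'x wit"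
  shows "\<forall>n. occurs F n (TreeS t) \<longrightarrow> finite (below F n)"
    and "\<forall>n. occurs F n (WitS w) \<longrightarrow> finite (below F n)"
proof (induction t and w)
  case (Exp M)
  show ?case
  proof (rule finite_below_if_children)
    fix s v assume "child (TreeS (Exp M)) s v"
    then obtain w k where "k < count M w" "v = WitS w" unfolding child_cases by blast
    moreover from this have "w \<in># M" by (metis count_inI not_less_zero)
    ultimately show "\<forall>n. occurs F n v \<longrightarrow> finite (below F n)" using Exp by simp
  qed
qed (rule finite_below_if_children; auto simp: child_cases;
     rule finite_below_if_children[rule_format]; auto simp: child_cases)+

lemma root_in_anc: "\<exists>m k. Root m k \<in> anc n"
  by (induction n) auto

lemma finite_nodes: "finite (nodes F)"
proof -
  let ?R = "{Root m k | m k. k < count F m}"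
  have fin: "finite (below F (Root m k))" if "k < count F m" for m k
  proof -
    have "occurs F (Root m k) (member_subterm m)" using that by (simp add: occurs_Root_iff)
    then show ?thesis using finite_below_subterm by (metis member_subterm.elims)
  qed
  have "finite ?R" using image_mset_copies[of Root F] by blast
  then have "finite (\<Union>r\<in>?R. below F r)" by (rule finite_UN_I) (use fin in blast)
  moreover have "nodes F \<subseteq> (\<Union>r\<in>?R. below F r)"
  proof
    fix n assume n: "n \<in> nodes F"
    obtain m k where mk: "Root m k \<in> anc n" using root_in_anc by blast
    then have "Root m k \<in> nodes F" using n anc_nodes by blast
    then have "k < count F m" by (auto simp: nodes_def occurs_Root_iff)
    then show "n \<in> (\<Union>r\<in>?R. below F r)" using mk n by (auto simp: below_def)
  qed
  ultimately show ?thesis using finite_subset by blast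
qed

section \<open>Slices\<close>

text \<open>
  \<open>Whole n A\<close> is the tree at the node \<open>n\<close> with type \<open>A\<close>; \<open>Part X A\<close> is an expansion whose summands are
  the witnesses at the nodes in \<open>X\<close>. The expansion node above the nodes in \<open>X\<close> does not belong to the
  item.
\<close>
datatype ('a, 'x) item = Whole "('a, 'x) node" "'a form" | Part "('a, 'x) node multiset" "'a form"

definition tree_at :: "('a, 'x) forest \<Rightarrow> ('a, 'x) node \<Rightarrow> 'x tree" where
  "tree_at F n = (THE t. occurs F n (TreeS t))"

definition wit_at :: "('a, 'x) forest \<Rightarrow> ('a, 'x) node \<Rightarrow> 'x wit" where
  "wit_at F n = (THE w. occurs F n (WitS w))"

lemma tree_at: "occurs F n (TreeS t) \<Longrightarrow> tree_at F n = t"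
  unfolding tree_at_def by (rule the_equality) (auto dest: occurs_unique)

lemma wit_at: "occurs F n (WitS w) \<Longrightarrow> wit_at F n = w"
  unfolding wit_at_def by (rule the_equality) (auto dest: occurs_unique)

fun item_member :: "('a, 'x) forest \<Rightarrow> ('a, 'x) item \<Rightarrow> ('a, 'x) member" where
  "item_member F (Whole n A) = TreeM (tree_at F n) A"
| "item_member F (Part X A) = TreeM (Exp (image_mset (wit_at F) X)) A"

fun item_tops :: "('a, 'x) item \<Rightarrow> ('a, 'x) node multiset" where
  "item_tops (Whole n A) = {#n#}"
| "item_tops (Part X A) = X"

fun item_ok :: "('a, 'x) forest \<Rightarrow> ('a, 'x) item \<Rightarrow> bool" where
  "item_ok F (Whole n A) \<longleftrightarrow> (\<exists>t. occurs F n (TreeS t))"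
| "item_ok F (Part X A) \<longleftrightarrow> (\<forall>n\<in>#X. \<exists>w. occurs F n (WitS w))"

abbreviation sequent :: "('a, 'x) forest \<Rightarrow> ('a, 'x) item multiset \<Rightarrow> ('a, 'x) forest" where
  "sequent F S \<equiv> image_mset (item_member F) S"

abbreviation tops :: "('a, 'x) item multiset \<Rightarrow> ('a, 'x) node multiset" where
  "tops S \<equiv> \<Sum>\<^sub># (image_mset item_tops S)"

text \<open>
  The number of elements of \<open>T\<close> below which \<open>m\<close> lies. That it is at most \<open>1\<close> everywhere says that the
  elements of \<open>T\<close> are distinct and that none is an ancestor of another. In this form the condition
  is additive in \<open>T\<close>, and passes on to any multiset that covers less.
\<close>
definition covers :: "('a, 'x) node multiset \<Rightarrow> ('a, 'x) node \<Rightarrow> nat" where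
  "covers T m = size {#n \<in># T. n \<in> anc m#}"

definition slice :: "('a, 'x) forest \<Rightarrow> ('a, 'x) item multiset \<Rightarrow> bool" where
  "slice F S \<longleftrightarrow> (\<forall>i\<in>#S. item_ok F i) \<and> (\<forall>m. covers (tops S) m \<le> 1)"

definition over :: "('a, 'x) forest \<Rightarrow> ('a, 'x) node multiset \<Rightarrow> ('a, 'x) node set" where
  "over F T = (\<Union>n\<in>set_mset T. below F n)"

lemma covers_simps [simp]:
  "covers {#} m = 0"
  "covers (T + U) m = covers T m + covers U m"
  "covers (add_mset n T) m = (if n \<in> anc m then 1 else 0) + covers T m"
  by (auto simp: covers_def)

lemma over_simps [simp]:
  "over F {#} = {}"
  "over F (T + U) = over F T \<union> over F U"
  "over F (add_mset n T) = below F n \<union> over F T"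
  by (auto simp: over_def)

lemma covers_pos: "n \<in># T \<Longrightarrow> n \<in> anc m \<Longrightarrow> covers T m \<ge> 1"
  by (auto dest!: multi_member_split)

lemma over_covers: "m \<in> over F T \<Longrightarrow> covers T m \<ge> 1"
  unfolding over_def below_def using covers_pos by fast

lemma covers_over: "m \<in> nodes F \<Longrightarrow> covers T m \<noteq> 0 \<Longrightarrow> m \<in> over F T"
  by (induction T) (auto simp: below_def split: if_splits)

lemma over_disjoint: "\<forall>m. covers (T + U) m \<le> 1 \<Longrightarrow> over F T \<inter> over F U = {}"
proof (intro equals0I)
  fix m assume "\<forall>m. covers (T + U) m \<le> 1" "m \<in> over F T \<inter> over F U"
  then have "covers T m + covers U m \<le> 1" "covers T m \<ge> 1" "covers U m \<ge> 1"
    using over_covers by (metis covers_simps(2)) (use \<open>m \<in> _\<close> over_covers in blast)+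
  then show False by simp
qed

lemma over_nodes: "over F T \<subseteq> nodes F"
  by (auto simp: over_def below_def)

lemma below_successors: "v \<in> below F n \<Longrightarrow> u \<in> successors F v \<Longrightarrow> u \<in> below F n"
  by (auto simp: below_def successors_Succ)

lemma over_successors: "v \<in> over F T \<Longrightarrow> u \<in> successors F v \<Longrightarrow> u \<in> over F T"
  unfolding over_def using below_successors by blast

abbreviation children :: "('a, 'x) forest \<Rightarrow> ('a, 'x) node \<Rightarrow> ('a, 'x) node multiset" where
  "children F n \<equiv> mset_set (successors F n)"

text \<open>
  A node can be replaced by its children: their subtrees are disjoint and lie in the subtree of the
  node.
\<close>
lemma covers_children: "covers (children F n) m \<le> covers {#n#} m"
proof (cases "n \<in> anc m")
  case True
  have "x = y" if xy: "x \<in> successors F n" "y \<in> successors F n" "x \<in> anc m" "y \<in> anc m" for x y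
  proof -
    obtain s s' where "x = Succ n s" "y = Succ n s'" using xy unfolding successors_Succ by blast
    then show ?thesis using anc_chain[OF xy(3,4)] Succ_not_anc by auto
  qed
  then have "card {x \<in> successors F n. x \<in> anc m} \<le> Suc 0"
    by (intro card_le_Suc0_iff_eq[THEN iffD2]) (auto simp: finite_successors)
  then show ?thesis using True by (simp add: covers_def)
next
  case False
  then have none: "{x \<in> successors F n. x \<in> anc m} = {}"
    by (auto simp: successors_Succ) (metis anc.simps(2) anc_refl anc_trans insertI2)
  show ?thesis by (simp add: covers_def none)
qed

lemma over_children: "over F {#n#} \<subseteq> insert n (over F (children F n))"
  using below_unfold by (auto simp: over_def finite_successors)

lemma children_Exp:
  assumes "occurs F n (TreeS (Exp M))"
  shows "image_mset (wit_at F) (children F n) = M" "\<forall>m\<in>#children F n. \<exists>w. occurs F m (WitS w)"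
proof -
  have "occurs F (Succ n (SummandS w k)) (WitS w)" if "k < count M w" for w k
    using that assms child.intros(9) by (auto simp: occurs_Succ_iff)
  then show "image_mset (wit_at F) (children F n) = M" "\<forall>m\<in>#children F n. \<exists>w. occurs F m (WitS w)"
    unfolding successors_Exp[OF assms]
    using image_mset_copies[of "\<lambda>w k. Succ n (SummandS w k)" M "wit_at F"] wit_at by (fastforce)+
qed

section \<open>Confining cusp-free cycles\<close>

lemma cusp_free_cycle_ends:
  assumes "region.cusp_free_cycle F R (n # ys)"
  shows "ys \<noteq> []" "hd ys \<in> R" "last ys \<in> R" "linked F (hd ys) n" "linked F (last ys) n"
    "\<not> same_class F n (last ys) (hd ys)" "set (n # ys) \<subseteq> R" "distinct (n # ys)"
    "successively (linked_in F R) ys"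
proof -
  have *: "2 \<le> length ys" "distinct (n # ys)" "successively (linked_in F R) (n # ys @ [n])"
    "\<not> same_class F n (last ys) (hd ys)"
    using assms unfolding region.cusp_free_cycle_Cons region.cusp_free_def by auto
  show "ys \<noteq> []" using * by auto
  then have "linked_in F R n (hd ys)" "linked_in F R (last ys) n" "successively (linked_in F R) ys"
    using * by (auto simp: successively_Cons successively_append_iff)
  then show "hd ys \<in> R" "last ys \<in> R" "linked F (hd ys) n" "linked F (last ys) n"
    "successively (linked_in F R) ys"
    using linked_sym by (auto simp: linked_in_def)
  show "\<not> same_class F n (last ys) (hd ys)" "distinct (n # ys)" using * by auto
  show "set (n # ys) \<subseteq> R" using assms cusp_free_cycle_iff by blast
qed

lemma cusp_free_cycle_subset:
  "region.cusp_free_cycle F R c \<Longrightarrow> set c \<subseteq> R' \<Longrightarrow> region.cusp_free_cycle F R' c"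
  unfolding cusp_free_cycle_iff by blast

lemma cusp_free_cycle_in: "region.cusp_free_cycle F R c \<Longrightarrow> set c \<subseteq> R"
  unfolding cusp_free_cycle_iff by blast

text \<open>
  A cycle passes through a node by two edges; so a node all of whose edges have one colour is on no
  cusp-free cycle.
\<close>
lemma acyclic_on_remove:
  assumes ac: "acyclic_on F (R - N)"
    and N: "\<And>n a b. n \<in> N \<Longrightarrow> n \<in> R \<Longrightarrow> a \<in> R \<Longrightarrow> b \<in> R \<Longrightarrow> linked F a n \<Longrightarrow> linked F b n \<Longrightarrow> same_class F n a b"
  shows "acyclic_on F R"
  unfolding acyclic_on_def
proof (intro allI notI)
  fix c assume c: "region.cusp_free_cycle F R c"
  show False
  proof (cases "set c \<inter> N = {}")
    case True
    then have "set c \<subseteq> R - N" using cusp_free_cycle_in[OF c] by blast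
    then show False using ac cusp_free_cycle_subset[OF c] by (auto simp: acyclic_on_def)
  next
    case False
    then obtain n where n: "n \<in> set c" "n \<in> N" by blast
    then obtain ys where ys: "region.cusp_free_cycle F R (n # ys)"
      using region.cusp_free_cycle_start_at[OF c] by metis
    from cusp_free_cycle_ends[OF ys] N[OF n(2), of "last ys" "hd ys"] show False by auto
  qed
qed

lemma walk_stays:
  assumes "\<And>a b. a \<in> R1 \<Longrightarrow> b \<in> R2 \<Longrightarrow> \<not> linked F a b"
    and "successively (linked_in F R) xs" "set xs \<subseteq> R1 \<union> R2" "xs \<noteq> []" "hd xs \<in> R1"
  shows "set xs \<subseteq> R1"
  using assms(2-)
proof (induction xs)
  case (Cons x xs)
  then show ?case using assms(1)[of x "hd xs"]
    by (cases xs) (auto simp: linked_in_def)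
qed simp

lemma acyclic_on_union:
  assumes ac: "acyclic_on F R1" "acyclic_on F R2"
    and sep: "\<And>a b. a \<in> R1 \<Longrightarrow> b \<in> R2 \<Longrightarrow> \<not> linked F a b"
  shows "acyclic_on F (R1 \<union> R2)"
  unfolding acyclic_on_def
proof (intro allI notI)
  fix c assume c: "region.cusp_free_cycle F (R1 \<union> R2) c"
  have walk: "successively (linked_in F (R1 \<union> R2)) c" "c \<noteq> []"
    using c by (auto simp: region.cusp_free_cycle_def region.cusp_free_def successively_append_iff)
  have sub: "set c \<subseteq> R1 \<union> R2" using cusp_free_cycle_in[OF c] .
  then consider "hd c \<in> R1" | "hd c \<in> R2" using walk(2) by (meson Un_iff hd_in_set subsetD)
  then show False
  proof cases
    case 1
    from walk_stays[OF sep walk(1) sub walk(2) this] show False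
      using ac cusp_free_cycle_subset[OF c] by (auto simp: acyclic_on_def)
  next
    case 2
    have sep': "\<And>a b. a \<in> R2 \<Longrightarrow> b \<in> R1 \<Longrightarrow> \<not> linked F a b" using sep linked_sym by blast
    have "set c \<subseteq> R2 \<union> R1" using sub by blast
    from walk_stays[OF sep' walk(1) this walk(2) 2] show False
      using ac cusp_free_cycle_subset[OF c] by (auto simp: acyclic_on_def)
  qed
qed

text \<open>
  A cycle through \<open>n\<close> enters and leaves it on the same side, since the rest of the cycle is connected
  without \<open>n\<close>; but \<open>n\<close> has only one neighbour on each side.
\<close>
lemma acyclic_on_bridge:
  assumes ac: "acyclic_on F (R1 \<union> R2)"
    and sep: "\<And>a b. a \<in> R1 \<Longrightarrow> b \<in> R2 \<Longrightarrow> \<not> linked F a b"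
    and one: "\<And>a b. a \<in> R1 \<Longrightarrow> b \<in> R1 \<Longrightarrow> linked F a n \<Longrightarrow> linked F b n \<Longrightarrow> a = b"
      "\<And>a b. a \<in> R2 \<Longrightarrow> b \<in> R2 \<Longrightarrow> linked F a n \<Longrightarrow> linked F b n \<Longrightarrow> a = b"
  shows "acyclic_on F (insert n (R1 \<union> R2))"
  unfolding acyclic_on_def
proof (intro allI notI)
  fix c assume c: "region.cusp_free_cycle F (insert n (R1 \<union> R2)) c"
  show False
  proof (cases "n \<in> set c")
    case False
    then have "set c \<subseteq> R1 \<union> R2" using cusp_free_cycle_in[OF c] by blast
    then show False using ac cusp_free_cycle_subset[OF c] by (auto simp: acyclic_on_def)
  next
    case True
    then obtain ys where ys: "region.cusp_free_cycle F (insert n (R1 \<union> R2)) (n # ys)"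
      using region.cusp_free_cycle_start_at[OF c] by metis
    note e = cusp_free_cycle_ends[OF ys]
    have sub: "set ys \<subseteq> R1 \<union> R2" using e by auto
    have ends: "hd ys \<noteq> last ys" using e(6) by (auto simp: same_class_def)
    have ends_in: "hd ys \<in> set ys" "last ys \<in> set ys" using e(1) by auto
    then consider "hd ys \<in> R1" | "hd ys \<in> R2" using sub by blast
    then show False
    proof cases
      case 1
      from walk_stays[OF sep e(9) sub e(1) this] show False
        using one(1)[OF _ _ e(4,5)] ends ends_in by blast
    next
      case 2
      have sep': "\<And>a b. a \<in> R2 \<Longrightarrow> b \<in> R1 \<Longrightarrow> \<not> linked F a b" using sep linked_sym by blast
      have "set ys \<subseteq> R2 \<union> R1" using sub by blast
      from walk_stays[OF sep' e(9) this e(1) 2] show False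
        using one(2)[OF _ _ e(4,5)] ends ends_in by blast
    qed
  qed
qed

lemma acyclic_on_small:
  assumes "R \<subseteq> {a, b}"
  shows "acyclic_on F R"
  unfolding acyclic_on_def
proof (intro allI notI)
  fix c assume "region.cusp_free_cycle F R c"
  then have "3 \<le> length c" "distinct c" "set c \<subseteq> {a, b}" using assms unfolding cusp_free_cycle_iff by blast+
  then have "card (set c) \<le> card {a, b}" "card (set c) = length c"
    using card_mono[of "{a, b}" "set c"] distinct_card[of c] by simp_all
  moreover have "card {a, b} \<le> 2" by (simp add: card_insert_if)
  ultimately show False using \<open>3 \<le> length c\<close> by simp
qed

lemma covers_eq:
  assumes "covers T m \<le> 1" "a \<in># T" "b \<in># T" "a \<in> anc m" "b \<in> anc m"
  shows "a = b"
proof (rule ccontr)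
  assume "a \<noteq> b"
  then obtain U where "T = add_mset a (add_mset b U)"
    using assms(2,3) by (metis insert_noteq_member multi_member_split)
  then show False using assms by simp
qed

text \<open>
  The predecessor of a top node does not lie over the slice, since the tops would cover the node twice
  otherwise.
\<close>
lemma linked_top:
  assumes T: "\<forall>m. covers T m \<le> 1" and n: "n \<in># T" and u: "u \<in> over F T" and l: "linked F u n"
  shows "u \<in> successors F n \<or> axiom_link F u n \<or> axiom_link F n u"
proof -
  have "n \<notin> successors F u"
  proof
    assume "n \<in> successors F u"
    then obtain s where s: "n = Succ u s" by (auto simp: successors_Succ)
    obtain x where x: "x \<in># T" "x \<in> anc u" using u by (auto simp: over_def below_def)
    then have "x \<in> anc n" using s by simp
    then have "x = n" using covers_eq[of T n] T x n anc_refl by blast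
    then show False using x s Succ_not_anc by blast
  qed
  then show ?thesis using l unfolding linked_iff by blast
qed

lemma linked_top_no_wire:
  assumes "\<forall>m. covers T m \<le> 1" "n \<in># T" "u \<in> over F T" "linked F u n" "occurs F n x"
    "\<And>v. x \<noteq> WitS (Wire v)"
  shows "u \<in> successors F n"
  using linked_top[OF assms(1-4)] occurs_unique[OF assms(5)] assms(6)
  unfolding axiom_link_def by blast

text \<open>
  What remains of the edges of a switched node at the top are its successor edges, and these have one
  colour.
\<close>
lemma acyclic_on_switched_tops:
  assumes T: "\<forall>m. covers T m \<le> 1"
    and ac: "acyclic_on F R" and sub: "R \<subseteq> over F T"
    and tops: "\<And>n. n \<in> over F T - R \<Longrightarrow> n \<in># T \<and> switched F n"
  shows "acyclic_on F (over F T)"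
proof (rule acyclic_on_remove[of F _ "over F T - R"])
  show "acyclic_on F (over F T - (over F T - R))" using ac by (rule acyclic_on_mono) blast
next
  fix n a b
  assume n: "n \<in> over F T - R" and ab: "a \<in> over F T" "b \<in> over F T" "linked F a n" "linked F b n"
  have "n \<in># T" "switched F n" using tops[OF n] by auto
  then have "a \<in> successors F n" "b \<in> successors F n"
    using linked_top[OF T] ab axiom_link_no_successors(2)[of F n] by blast+
  then show "same_class F n a b" using \<open>switched F n\<close> by (auto simp: same_class_def)
qed

section \<open>Wires of a slice\<close>

fun wires_sub :: "'x subterm \<Rightarrow> 'x wire multiset" where
  "wires_sub (TreeS t) = wires_tree t"
| "wires_sub (WitS w) = wires_wit w"
| "wires_sub Star = {#}"

lemma wires_child: "child u s v \<Longrightarrow> v' \<in># wires_sub v \<Longrightarrow> v' \<in># wires_sub u"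
proof (induction rule: child.induct)
  case (9 k M w)
  then have "w \<in># M" by (metis count_inI not_less_zero)
  then show ?case using 9 by auto
qed auto

lemma wires_above:
  assumes "n \<in> anc m" "occurs F n u" "occurs F m (WitS (Wire v))"
  shows "v \<in># wires_sub u"
proof -
  have "\<lbrakk>n \<in> anc m; occurs F m u'; v \<in># wires_sub u'\<rbrakk> \<Longrightarrow> v \<in># wires_sub u" for u'
  proof (induction m arbitrary: u')
    case (Root m k)
    then show ?case using assms(2) occurs_unique by fastforce
  next
    case (Succ m s)
    show ?case
    proof (cases "n = Succ m s")
      case True
      then show ?thesis using assms(2) Succ occurs_unique by blast
    next
      case False
      then have "n \<in> anc m" using Succ.prems by simp
      moreover obtain u'' where "occurs F m u''" "child u'' s u'"
        using Succ.prems occurs_Succ_iff by blast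
      ultimately show ?thesis using Succ.IH Succ.prems wires_child by blast
    qed
  qed
  from this[OF assms(1,3)] show ?thesis by simp
qed

lemma wire_below:
  fixes t :: "'x tree" and w :: "'x wit"
  shows "\<forall>n. occurs F n (TreeS t) \<longrightarrow> v \<in># wires_tree t \<longrightarrow>
      (\<exists>m. n \<in> anc m \<and> occurs F m (WitS (Wire v)))"
    and "\<forall>n. occurs F n (WitS w) \<longrightarrow> v \<in># wires_wit w \<longrightarrow>
      (\<exists>m. n \<in> anc m \<and> occurs F m (WitS (Wire v)))"
proof -
  define P where "P u v' \<longleftrightarrow> (\<forall>n. occurs F n u \<longrightarrow> v' \<in># wires_sub u \<longrightarrow>
    (\<exists>m. n \<in> anc m \<and> occurs F m (WitS (Wire v'))))" for u v'
  have step: "\<exists>m. n \<in> anc m \<and> occurs F m (WitS (Wire v))"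
    if n: "occurs F n u" and c: "child u s u'" and v: "v \<in># wires_sub u'" and P: "P u' v" for n u s u'
  proof -
    have "occurs F (Succ n s) u'" using n c occurs_Succ_iff by blast
    then obtain m where m: "Succ n s \<in> anc m" "occurs F m (WitS (Wire v))" using P v unfolding P_def by blast
    have "n \<in> anc (Succ n s)" by (simp add: anc_refl)
    then show ?thesis using m anc_trans by blast
  qed
  have "P (TreeS t) v" "P (WitS w) v"
  proof (induction t and w)
    case (Exp M)
    show ?case unfolding P_def
    proof (intro allI impI)
      fix n assume n: "occurs F n (TreeS (Exp M))" and "v \<in># wires_sub (TreeS (Exp M))"
      then obtain w where w: "w \<in># M" "v \<in># wires_wit w" by auto
      then have "child (TreeS (Exp M)) (SummandS w 0) (WitS w)" by (intro child.intros) simp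
      then show "\<exists>m. n \<in> anc m \<and> occurs F m (WitS (Wire v))" using step[OF n] w Exp by simp
    qed
  next
    case (Disj t s)
    then show ?case unfolding P_def[of "TreeS (Disj t s)"]
      using step child.intros(1,2) by (metis UnE set_mset_union wires_sub.simps(1) wires_tree.simps(3))
  next
    case (OrL t)
    then show ?case unfolding P_def[of "TreeS (OrL t)"]
      using step child.intros(3) by (metis wires_sub.simps(1) wires_tree.simps(4))
  next
    case (OrR t)
    then show ?case unfolding P_def[of "TreeS (OrR t)"]
      using step child.intros(6) by (metis wires_sub.simps(1) wires_tree.simps(5))
  next
    case (Tensor t s)
    then show ?case unfolding P_def[of "WitS (Tensor t s)"]
      using step child.intros(7,8) by (metis UnE set_mset_union wires_sub.simps wires_wit.simps(2))
  next
    case One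
    show ?case by (simp add: P_def)
  next
    case (Wire x)
    show ?case using anc_refl by (auto simp: P_def)
  qed
  then show "\<forall>n. occurs F n (TreeS t) \<longrightarrow> v \<in># wires_tree t \<longrightarrow>
      (\<exists>m. n \<in> anc m \<and> occurs F m (WitS (Wire v)))"
    "\<forall>n. occurs F n (WitS w) \<longrightarrow> v \<in># wires_wit w \<longrightarrow>
      (\<exists>m. n \<in> anc m \<and> occurs F m (WitS (Wire v)))"
    unfolding P_def by auto
qed

lemma in_wires_sub_iff:
  assumes "occurs F n u"
  shows "v \<in># wires_sub u \<longleftrightarrow> (\<exists>m\<in>below F n. occurs F m (WitS (Wire v)))"
proof
  assume "v \<in># wires_sub u"
  then have "\<exists>m. n \<in> anc m \<and> occurs F m (WitS (Wire v))"
    using assms wire_below(1)[rule_format] wire_below(2)[rule_format]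
    by (cases u) (simp_all, blast+)
  then show "\<exists>m\<in>below F n. occurs F m (WitS (Wire v))" using occurs_nodes by (auto simp: below_def)
next
  assume "\<exists>m\<in>below F n. occurs F m (WitS (Wire v))"
  then show "v \<in># wires_sub u" using wires_above assms by (auto simp: below_def)
qed

lemma in_wires_item_iff:
  assumes "item_ok F i"
  shows "v \<in># wires_member (item_member F i) \<longleftrightarrow>
    (\<exists>m\<in>over F (item_tops i). occurs F m (WitS (Wire v)))"
proof (cases i)
  case (Whole n A)
  then obtain t where t: "occurs F n (TreeS t)" using assms by auto
  then show ?thesis using in_wires_sub_iff[OF t] Whole by (simp add: tree_at)
next
  case (Part X A)
  have "v \<in># wires_wit (wit_at F n) \<longleftrightarrow> (\<exists>m\<in>below F n. occurs F m (WitS (Wire v)))" if n: "n \<in># X" for n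
  proof -
    obtain w where w: "occurs F n (WitS w)" using assms Part n by auto
    then show ?thesis using in_wires_sub_iff[OF w] by (simp add: wit_at)
  qed
  then show ?thesis using Part by (auto simp: over_def)
qed

lemma wires_simps [simp]:
  "wires {#} = {#}"
  "wires (G + H) = wires G + wires H"
  "wires (add_mset m G) = wires_member m + wires G"
  by (auto simp: wires_def)

text \<open>
  Conditions of the calculus on the wires of a sequent become conditions on the nodes over a slice.
\<close>
lemma in_wires_sequent_iff:
  assumes "\<forall>i\<in>#S. item_ok F i"
  shows "v \<in># wires (sequent F S) \<longleftrightarrow> (\<exists>m\<in>over F (tops S). occurs F m (WitS (Wire v)))"
  using assms by (induction S) (auto simp: in_wires_item_iff)

section \<open>Replacing and opening items\<close>

lemma over_mono:
  assumes "\<And>m. covers T m \<le> covers U m"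
  shows "over F T \<subseteq> over F U"
proof
  fix m assume m: "m \<in> over F T"
  have "covers U m \<noteq> 0" using over_covers[OF m] assms[of m] by simp
  then show "m \<in> over F U" using m over_nodes covers_over by blast
qed

lemma sliceI: "(\<And>i. i \<in># S \<Longrightarrow> item_ok F i) \<Longrightarrow> (\<And>m. covers (tops S) m \<le> 1) \<Longrightarrow> slice F S"
  by (simp add: slice_def)

lemma slice_ok: "slice F S \<Longrightarrow> i \<in># S \<Longrightarrow> item_ok F i"
  by (simp add: slice_def)

lemma slice_covers: "slice F S \<Longrightarrow> \<forall>m. covers (tops S) m \<le> 1"
  by (simp add: slice_def)

lemma slice_replace:
  assumes "slice F (S + U)" "\<And>i. i \<in># V \<Longrightarrow> item_ok F i"
    "\<And>m. covers (tops V) m \<le> covers (tops U) m"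
  shows "slice F (S + V)"
proof (rule sliceI)
  fix i assume "i \<in># S + V"
  then show "item_ok F i" using assms(1,2) slice_ok by fastforce
next
  fix m
  have "covers (tops (S + U)) m \<le> 1" using slice_covers[OF assms(1)] by blast
  then show "covers (tops (S + V)) m \<le> 1" using assms(3)[of m] by simp
qed

lemma slice_replace_top:
  assumes "slice F (add_mset i S)" "\<And>j. j \<in># V \<Longrightarrow> item_ok F j"
    "\<And>m. covers (tops V) m \<le> covers (item_tops i) m"
  shows "slice F (S + V)" "over F (tops (S + V)) \<subseteq> over F (tops (add_mset i S))"
proof -
  show "slice F (S + V)" using slice_replace[of F S "{#i#}" V] assms by simp
  show "over F (tops (S + V)) \<subseteq> over F (tops (add_mset i S))"
    using over_mono[of "tops V" "item_tops i" F] assms(3) by auto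
qed

lemma slice_sub:
  assumes "slice F (S + U)"
  shows "slice F S" "slice F U"
  using slice_replace[of F S U "{#}"] slice_replace[of F U S "{#}"] assms by (simp_all add: add.commute)

text \<open>
  A tree item whose tree is an expansion presents the same member as the part that consists of all
  its summands. Opened slices thus present expansions by parts only, which can be cut further.
\<close>
fun opened :: "('a, 'x) forest \<Rightarrow> ('a, 'x) item \<Rightarrow> ('a, 'x) item" where
  "opened F (Whole n A) =
     (if \<exists>M. occurs F n (TreeS (Exp M)) then Part (children F n) A else Whole n A)"
| "opened F (Part X A) = Part X A"

lemma opened_ok: "item_ok F i \<Longrightarrow> item_ok F (opened F i)"
  by (cases i) (auto dest: children_Exp(2))

lemma opened_member: "item_ok F i \<Longrightarrow> item_member F (opened F i) = item_member F i"
  by (cases i) (auto simp: children_Exp(1), metis tree_at)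

lemma opened_covers: "covers (item_tops (opened F i)) m \<le> covers (item_tops i) m"
proof (cases i)
  case (Whole n A)
  then show ?thesis using covers_children[of F n m] by (auto split: if_splits)
qed simp

lemma opened_over:
  "over F (item_tops (opened F i)) \<subseteq> over F (item_tops i)"
  "n \<in> over F (item_tops i) \<Longrightarrow> n \<notin> over F (item_tops (opened F i)) \<Longrightarrow>
    n \<in># item_tops i \<and> switched F n"
proof -
  show "over F (item_tops (opened F i)) \<subseteq> over F (item_tops i)"
    by (rule over_mono[OF opened_covers])
  show "n \<in># item_tops i \<and> switched F n"
    if n: "n \<in> over F (item_tops i)" "n \<notin> over F (item_tops (opened F i))"
  proof (cases i)
    case (Whole m A)
    show ?thesis
    proof (cases "\<exists>M. occurs F m (TreeS (Exp M))")
      case True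
      then have "n = m" using n Whole over_children[of F m] by auto
      then show ?thesis using True Whole by (auto simp: switched_def)
    next
      case False
      then show ?thesis using n Whole by simp
    qed
  next
    case (Part X A)
    then show ?thesis using n by simp
  qed
qed

abbreviation opened_items :: "('a, 'x) forest \<Rightarrow> ('a, 'x) item multiset \<Rightarrow> ('a, 'x) item multiset" where
  "opened_items F S \<equiv> image_mset (opened F) S"

lemma opened_items_covers: "covers (tops (opened_items F S)) m \<le> covers (tops S) m"
  by (induction S) (auto intro: add_mono opened_covers)

lemma opened_items_slice:
  assumes "slice F S"
  shows "slice F (opened_items F S)" "sequent F (opened_items F S) = sequent F S"
proof -
  show "slice F (opened_items F S)"
    using slice_replace[of F "{#}" S "opened_items F S"] assms opened_ok slice_ok opened_items_covers
    by fastforce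
  show "sequent F (opened_items F S) = sequent F S"
    using assms by (simp add: multiset.map_comp comp_def slice_ok opened_member cong: image_mset_cong)
qed

lemma opened_items_over: "over F (tops (opened_items F S)) \<subseteq> over F (tops S)"
  using opened_over(1)[of F] by (induction S) (simp_all, blast)

lemma opened_items_acyclic:
  assumes S: "slice F S" and ac: "acyclic_on F (over F (tops (opened_items F S)))"
  shows "acyclic_on F (over F (tops S))"
proof (rule acyclic_on_switched_tops[OF slice_covers[OF S] ac opened_items_over])
  fix n assume "n \<in> over F (tops S) - over F (tops (opened_items F S))"
  then have "n \<in> over F (tops S)" "n \<notin> over F (tops (opened_items F S))" by auto
  then show "n \<in># tops S \<and> switched F n"
  proof (induction S)
    case (add i S)
    then show ?case using opened_over(2)[of n F i] by auto
  qed simp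
qed

definition is_open :: "('a, 'x) forest \<Rightarrow> ('a, 'x) item \<Rightarrow> bool" where
  "is_open F i \<longleftrightarrow> item_ok F i \<and> opened F i = i"

lemma opened_is_open: "item_ok F i \<Longrightarrow> is_open F (opened F i)"
  unfolding is_open_def by (cases i) (auto dest: children_Exp(2))

lemma open_expansion:
  assumes "is_open F i" "item_member F i = TreeM (Exp M) C"
  obtains X where "i = Part X C" "image_mset (wit_at F) X = M" "\<forall>n\<in>#X. \<exists>w. occurs F n (WitS w)"
proof (cases i)
  case (Whole n A)
  then show ?thesis using assms by (auto simp: is_open_def tree_at split: if_splits)
next
  case (Part X A)
  then show ?thesis using that assms by (auto simp: is_open_def)
qed

lemma whole_item:
  assumes "item_ok F i" "item_member F i = TreeM t C" "\<And>M. t \<noteq> Exp M"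
  obtains n where "i = Whole n C" "occurs F n (TreeS t)"
  using assms by (cases i) (auto simp: tree_at)

section \<open>Derivable slices have no cusp-free cycles\<close>

text \<open>
  The statement about a sequent \<open>H\<close> that is proved by induction on derivations: the forest \<open>F\<close> is
  fixed, while the same sequent may be presented by several slices.
\<close>
definition acyclic_slices :: "('a, 'x) forest \<Rightarrow> ('a, 'x) forest \<Rightarrow> bool" where
  "acyclic_slices F H \<longleftrightarrow> (\<forall>S. slice F S \<and> sequent F S = H \<longrightarrow> acyclic_on F (over F (tops S)))"

lemma acyclic_slicesI:
  assumes "\<And>S. slice F S \<Longrightarrow> \<forall>i\<in>#S. is_open F i \<Longrightarrow> sequent F S = H \<Longrightarrow> acyclic_on F (over F (tops S))"
  shows "acyclic_slices F H"
  unfolding acyclic_slices_def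
proof (intro allI impI, elim conjE)
  fix S assume S: "slice F S" "sequent F S = H"
  have "\<forall>i\<in>#opened_items F S. is_open F i" using opened_is_open slice_ok[OF S(1)] by auto
  then show "acyclic_on F (over F (tops S))"
    using assms opened_items_slice[OF S(1)] opened_items_acyclic[OF S(1)] S(2) by simp
qed

lemma acyclic_slicesD:
  "acyclic_slices F H \<Longrightarrow> slice F S \<Longrightarrow> sequent F S = H \<Longrightarrow> acyclic_on F (over F (tops S))"
  by (simp add: acyclic_slices_def)

lemma sequent_add:
  assumes "sequent F S = add_mset m H"
  obtains i S' where "S = add_mset i S'" "item_member F i = m" "sequent F S' = H"
  using msed_map_invR[OF assms] by blast

lemma children_simps:
  "occurs F n (TreeS One) \<Longrightarrow> children F n = {#}"
  "occurs F n (WitS (Wire v)) \<Longrightarrow> children F n = {#}"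
  "occurs F n (TreeS (Disj t s)) \<Longrightarrow> children F n = {#Succ n LeftS, Succ n RightS#}"
  "occurs F n (TreeS (OrL t)) \<Longrightarrow> children F n = {#Succ n LeftS, Succ n RightS#}"
  "occurs F n (TreeS (OrR t)) \<Longrightarrow> children F n = {#Succ n LeftS, Succ n RightS#}"
  "occurs F n (WitS (Tensor t s)) \<Longrightarrow> children F n = {#Succ n LeftS, Succ n RightS#}"
proof -
  have *: "children F n = {#Succ n LeftS, Succ n RightS#}"
    if "successors F n = {Succ n LeftS, Succ n RightS}" using that by simp
  have **: "{Succ n s' | s' v. s' = LeftS \<and> v = a \<or> s' = RightS \<and> v = b} = {Succ n LeftS, Succ n RightS}"
    for a b :: "'b subterm" by auto
  show "occurs F n (TreeS One) \<Longrightarrow> children F n = {#}"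
    "occurs F n (WitS (Wire v)) \<Longrightarrow> children F n = {#}"
    by (auto simp: successors_of child_cases)
  show "occurs F n (TreeS (Disj t s)) \<Longrightarrow> children F n = {#Succ n LeftS, Succ n RightS#}"
    "occurs F n (TreeS (OrL t)) \<Longrightarrow> children F n = {#Succ n LeftS, Succ n RightS#}"
    "occurs F n (TreeS (OrR t)) \<Longrightarrow> children F n = {#Succ n LeftS, Succ n RightS#}"
    "occurs F n (WitS (Tensor t s)) \<Longrightarrow> children F n = {#Succ n LeftS, Succ n RightS#}"
    by (intro *; simp only: successors_of child_cases **)+
qed

lemma occurs_children:
  "occurs F n (TreeS (Disj t s)) \<Longrightarrow> occurs F (Succ n LeftS) (TreeS t) \<and> occurs F (Succ n RightS) (TreeS s)"
  "occurs F n (TreeS (OrL t)) \<Longrightarrow> occurs F (Succ n LeftS) (TreeS t) \<and> occurs F (Succ n RightS) Star"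
  "occurs F n (TreeS (OrR t)) \<Longrightarrow> occurs F (Succ n LeftS) Star \<and> occurs F (Succ n RightS) (TreeS t)"
  "occurs F n (WitS (Tensor t s)) \<Longrightarrow> occurs F (Succ n LeftS) (TreeS t) \<and> occurs F (Succ n RightS) (TreeS s)"
  using child.intros by (metis occurs_Succ_iff)+

lemma over_leaf: "children F n = {#} \<Longrightarrow> over F {#n#} \<subseteq> {n}"
  using over_children[of F n] by simp

lemma LK_e_wires_dual: "LK_e H \<Longrightarrow> PosW x \<in># wires H \<longleftrightarrow> NegW x \<in># wires H"
  by (induction rule: LK_e.induct) auto

text \<open>
  Two parts of a slice can only be linked by the two ends of a wire. The first part contains both ends
  or none, and shares no end with the second.
\<close>
lemma not_linked_if_disjoint_slices:
  assumes S: "slice F (S1 + S2)"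
    and dual: "\<And>x. PosW x \<in># wires (sequent F S1) \<longleftrightarrow> NegW x \<in># wires (sequent F S1)"
    and dis: "set_mset (wires (sequent F S1)) \<inter> set_mset (wires (sequent F S2)) = {}"
    and ab: "a \<in> over F (tops S1)" "b \<in> over F (tops S2)"
  shows "\<not> linked F a b"
proof
  assume "linked F a b"
  have ok: "\<forall>i\<in>#S1. item_ok F i" "\<forall>i\<in>#S2. item_ok F i" using slice_ok[OF S] by auto
  have "over F (tops S1) \<inter> over F (tops S2) = {}"
    using over_disjoint[of "tops S1" "tops S2" F] slice_covers[OF S] by simp
  then have "a \<notin> successors F b" "b \<notin> successors F a" using ab over_successors by blast+
  then have "axiom_link F a b \<or> axiom_link F b a" using \<open>linked F a b\<close> linked_iff by blast
  then obtain x where "occurs F a (WitS (Wire (PosW x))) \<and> occurs F b (WitS (Wire (NegW x))) \<or>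
      occurs F b (WitS (Wire (PosW x))) \<and> occurs F a (WitS (Wire (NegW x)))"
    unfolding axiom_link_def by blast
  then have "PosW x \<in># wires (sequent F S1) \<and> NegW x \<in># wires (sequent F S2) \<or>
      NegW x \<in># wires (sequent F S1) \<and> PosW x \<in># wires (sequent F S2)"
    using in_wires_sequent_iff[OF ok(1)] in_wires_sequent_iff[OF ok(2)] ab by blast
  then show False using dual[of x] dis by blast
qed

text \<open>
  In \<open>(t \<or> *)\<close> and \<open>(* \<or> t)\<close>, the leaf \<open>*\<close> has the node as its only neighbour; without it, the node
  has only one neighbour left. The disjunction itself is not switched, so that its edges differ in
  colour.
\<close>
lemma half_disjunction_acyclic:
  assumes T: "\<forall>m. covers (add_mset n T) m \<le> 1"
    and kids: "children F n = {#c, d#}" and n: "occurs F n (TreeS t)" and d: "occurs F d Star"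
    and ac: "acyclic_on F (over F (add_mset c T))"
  shows "acyclic_on F (over F (add_mset n T))"
proof (rule acyclic_on_remove)
  let ?R = "over F (add_mset n T)"
  have succ: "successors F n = {c, d}"
    using arg_cong[OF kids, of set_mset] by simp
  have d_link: "a = n" if "linked F a d" for a
  proof -
    have "successors F d = {}" using d by (auto simp: successors_of child_cases)
    moreover have "\<not> axiom_link F a d" "\<not> axiom_link F d a"
      using occurs_unique[OF d] by (auto simp: axiom_link_def)
    ultimately have "d \<in> successors F a" using \<open>linked F a d\<close> by (auto simp: linked_iff)
    moreover have "d \<in> successors F n" using succ by simp
    ultimately show ?thesis by (auto simp: successors_Succ)
  qed
  show "same_class F m a b" if "m \<in> {d}" "linked F a m" "linked F b m" for m a b
    using that d_link by (auto simp: same_class_def)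
  show "acyclic_on F (?R - {d})"
  proof (rule acyclic_on_remove)
    show "same_class F m a b" if m: "m \<in> {n}" and ab: "a \<in> ?R - {d}" "b \<in> ?R - {d}" "linked F a m" "linked F b m" for m a b
    proof -
      have "x = c" if "x \<in> ?R - {d}" "linked F x n" for x
      proof -
        have "x \<in> successors F n" using linked_top_no_wire[OF T _ _ that(2) n] that(1) by simp
        then show ?thesis using succ that(1) by blast
      qed
      then show ?thesis using m ab by (auto simp: same_class_def)
    qed
    have "over F {#n#} \<subseteq> insert n (over F {#c, d#})" using over_children[of F n] kids by simp
    moreover have "over F {#d#} \<subseteq> {d}" using d by (intro over_leaf) (auto simp: successors_of child_cases)
    ultimately have "?R - {d} - {n} \<subseteq> over F (add_mset c T)" by auto
    then show "acyclic_on F (?R - {d} - {n})" using ac acyclic_on_mono by blast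
  qed
qed

text \<open>
  Each rule is read from the conclusion to the premisses: a slice that presents the conclusion is
  changed into slices that present the premisses, and a cusp-free cycle cannot use the nodes that get
  lost. The contraction rule does not change the nodes at all.
\<close>
lemma acyclic_slices_if_LK_e: "LK_e H \<Longrightarrow> acyclic_slices F H"
proof (induction rule: LK_e.induct)
  case top_ax
  show ?case
  proof (rule acyclic_slicesI)
    fix S assume S: "slice F S" "\<forall>i\<in>#S. is_open F i" "sequent F S = {#TreeM One Top#}"
    then obtain i where i: "S = {#i#}" "item_member F i = TreeM One Top" by (auto elim!: sequent_add)
    have "item_ok F i" using slice_ok[OF S(1)] i(1) by simp
    then obtain n where "i = Whole n Top" "occurs F n (TreeS One)"
      by (rule whole_item[OF _ i(2)]) auto
    then have "over F (tops S) \<subseteq> {n, n}" using over_leaf[OF children_simps(1)] i by fastforce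
    then show "acyclic_on F (over F (tops S))" by (rule acyclic_on_small)
  qed
next
  case (id_ax x p)
  show ?case
  proof (rule acyclic_slicesI)
    fix S assume S: "slice F S" "\<forall>i\<in>#S. is_open F i"
      "sequent F S = {#TreeM (Exp {#Wire (NegW x)#}) (NAtom p), TreeM (Exp {#Wire (PosW x)#}) (Atom p)#}"
    have leaf: "\<exists>n. over F (item_tops i) \<subseteq> {n}"
      if i: "is_open F i" "item_member F i = TreeM (Exp {#Wire v#}) C" for i v C
    proof -
      obtain X where X: "i = Part X C" "image_mset (wit_at F) X = {#Wire v#}"
        "\<forall>n\<in>#X. \<exists>w. occurs F n (WitS w)" using open_expansion[OF i] .
      then obtain n where n: "X = {#n#}" "wit_at F n = Wire v" by (auto dest!: msed_map_invR)
      then have "occurs F n (WitS (Wire v))" using X wit_at by fastforce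
      then have "over F {#n#} \<subseteq> {n}" by (intro over_leaf children_simps(2))
      then show ?thesis using X n by auto
    qed
    obtain i S' where "S = add_mset i S'" "item_member F i = TreeM (Exp {#Wire (NegW x)#}) (NAtom p)"
      "sequent F S' = {#TreeM (Exp {#Wire (PosW x)#}) (Atom p)#}" using sequent_add[OF S(3)] .
    moreover obtain j where "S' = {#j#}" "item_member F j = TreeM (Exp {#Wire (PosW x)#}) (Atom p)"
      using sequent_add[OF \<open>sequent F S' = _\<close>] by auto
    moreover obtain n m where "over F (item_tops i) \<subseteq> {n}" "over F (item_tops j) \<subseteq> {m}"
      using leaf calculation S(2) by (metis union_single_eq_member add_mset_commute)
    ultimately have "over F (tops S) \<subseteq> {n, m}" by auto
    then show "acyclic_on F (over F (tops S))" by (rule acyclic_on_small)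
  qed
next
  case (mix G H)
  show ?case
  proof (rule acyclic_slicesI)
    fix S assume S: "slice F S" "sequent F S = G + H"
    then obtain S1 S2 where eq: "S = S1 + S2" "sequent F S1 = G" "sequent F S2 = H"
      by (metis image_mset_eq_plusD)
    have sl: "slice F S1" "slice F S2" using slice_sub S(1) eq(1) by blast+
    have "acyclic_on F (over F (tops S1) \<union> over F (tops S2))"
    proof (rule acyclic_on_union)
      show "acyclic_on F (over F (tops S1))" "acyclic_on F (over F (tops S2))"
        using mix.IH sl eq acyclic_slicesD by blast+
      show "\<not> linked F a b" if "a \<in> over F (tops S1)" "b \<in> over F (tops S2)" for a b
        by (rule not_linked_if_disjoint_slices[OF _ _ _ that])
          (use S(1) eq mix.hyps(3) LK_e_wires_dual[OF mix.hyps(1)] in auto)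
    qed
    then show "acyclic_on F (over F (tops S))" using eq by simp
  qed
next
  case (or G t A s B)
  show ?case
  proof (rule acyclic_slicesI)
    fix S assume S: "slice F S" "\<forall>i\<in>#S. is_open F i" "sequent F S = G + {#TreeM (Disj t s) (Or A B)#}"
    then obtain i S' where i: "S = add_mset i S'" "item_member F i = TreeM (Disj t s) (Or A B)" "sequent F S' = G"
      using sequent_add by (metis add_mset_add_single)
    have "item_ok F i" using slice_ok[OF S(1)] i(1) by simp
    then obtain n where n: "i = Whole n (Or A B)" "occurs F n (TreeS (Disj t s))"
      by (rule whole_item[OF _ i(2)]) auto
    note kids = children_simps(3)[OF n(2)] and occ = occurs_children(1)[OF n(2)]
    define V where "V = {#Whole (Succ n LeftS) A, Whole (Succ n RightS) B#}"
    have tV: "tops V = children F n" unfolding V_def kids by simp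
    have "slice F (S' + V)"
    proof (rule slice_replace)
      show "slice F (S' + {#i#})" using S(1) i by simp
      show "item_ok F j" if "j \<in># V" for j using that occ by (auto simp: V_def)
      show "covers (tops V) m \<le> covers (tops {#i#}) m" for m
        using covers_children[of F n m] tV n by simp
    qed
    moreover have "sequent F (S' + V) = G + {#TreeM t A, TreeM s B#}"
      using i occ by (auto simp: V_def tree_at)
    ultimately have ac: "acyclic_on F (over F (tops (S' + V)))"
      using or.IH acyclic_slicesD by blast
    show "acyclic_on F (over F (tops S))"
    proof (rule acyclic_on_switched_tops[OF slice_covers[OF S(1)]])
      show "acyclic_on F (over F (tops S) \<inter> over F (tops (S' + V)))"
        using ac by (rule acyclic_on_mono) blast
      fix m assume m: "m \<in> over F (tops S) - over F (tops S) \<inter> over F (tops (S' + V))"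
      then have "m = n" using over_children[of F n] i n tV by auto
      then show "m \<in># tops S \<and> switched F m" using i n by (auto simp: switched_def)
    qed blast
  qed
next
  case (or0 G t A B)
  show ?case
  proof (rule acyclic_slicesI)
    fix S assume S: "slice F S" "\<forall>i\<in>#S. is_open F i" "sequent F S = G + {#TreeM (OrL t) (Or A B)#}"
    then obtain i S' where i: "S = add_mset i S'" "item_member F i = TreeM (OrL t) (Or A B)" "sequent F S' = G"
      using sequent_add by (metis add_mset_add_single)
    have "item_ok F i" using slice_ok[OF S(1)] i(1) by simp
    then obtain n where n: "i = Whole n (Or A B)" "occurs F n (TreeS (OrL t))"
      by (rule whole_item[OF _ i(2)]) auto
    note kids = children_simps(4)[OF n(2)] and occ = occurs_children(2)[OF n(2)]
    have "slice F (S' + {#Whole (Succ n LeftS) A#})"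
    proof (rule slice_replace)
      show "slice F (S' + {#i#})" using S(1) i by simp
      show "item_ok F j" if "j \<in># {#Whole (Succ n LeftS) A#}" for j using that occ by auto
      show "covers (tops {#Whole (Succ n LeftS) A#}) m \<le> covers (tops {#i#}) m" for m
        using covers_children[of F n m] n unfolding kids by simp
    qed
    moreover have "sequent F (S' + {#Whole (Succ n LeftS) A#}) = G + {#TreeM t A#}"
      using i occ by (auto simp: tree_at)
    ultimately have "acyclic_on F (over F (tops (S' + {#Whole (Succ n LeftS) A#})))"
      using or0.IH acyclic_slicesD by blast
    then show "acyclic_on F (over F (tops S))"
      using half_disjunction_acyclic[OF _ kids n(2) conjunct2[OF occ], of "tops S'"]
        slice_covers[OF S(1)] i n by simp
  qed
next
  case (or1 G s B A)
  show ?case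
  proof (rule acyclic_slicesI)
    fix S assume S: "slice F S" "\<forall>i\<in>#S. is_open F i" "sequent F S = G + {#TreeM (OrR s) (Or A B)#}"
    then obtain i S' where i: "S = add_mset i S'" "item_member F i = TreeM (OrR s) (Or A B)" "sequent F S' = G"
      using sequent_add by (metis add_mset_add_single)
    have "item_ok F i" using slice_ok[OF S(1)] i(1) by simp
    then obtain n where n: "i = Whole n (Or A B)" "occurs F n (TreeS (OrR s))"
      by (rule whole_item[OF _ i(2)]) auto
    note occ = occurs_children(3)[OF n(2)]
    have kids: "children F n = {#Succ n RightS, Succ n LeftS#}"
      using children_simps(5)[OF n(2)] by (simp add: add_mset_commute)
    have "slice F (S' + {#Whole (Succ n RightS) B#})"
    proof (rule slice_replace)
      show "slice F (S' + {#i#})" using S(1) i by simp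
      show "item_ok F j" if "j \<in># {#Whole (Succ n RightS) B#}" for j using that occ by auto
      show "covers (tops {#Whole (Succ n RightS) B#}) m \<le> covers (tops {#i#}) m" for m
        using covers_children[of F n m] n unfolding kids by simp
    qed
    moreover have "sequent F (S' + {#Whole (Succ n RightS) B#}) = G + {#TreeM s B#}"
      using i occ by (auto simp: tree_at)
    ultimately have "acyclic_on F (over F (tops (S' + {#Whole (Succ n RightS) B#})))"
      using or1.IH acyclic_slicesD by blast
    then show "acyclic_on F (over F (tops S))"
      using half_disjunction_acyclic[OF _ kids n(2) conjunct1[OF occ], of "tops S'"]
        slice_covers[OF S(1)] i n by simp
  qed
next
  case ("and" G t A H s B)
  show ?case
  proof (rule acyclic_slicesI)
    fix S assume S: "slice F S" "\<forall>i\<in>#S. is_open F i"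
      "sequent F S = G + H + {#TreeM (Exp {#Tensor t s#}) (And A B)#}"
    then obtain i S' where i: "S = add_mset i S'" "item_member F i = TreeM (Exp {#Tensor t s#}) (And A B)"
      "sequent F S' = G + H" using sequent_add by (metis add_mset_add_single)
    then obtain S1 S2 where eq: "S' = S1 + S2" "sequent F S1 = G" "sequent F S2 = H"
      by (metis image_mset_eq_plusD)
    obtain X where X: "i = Part X (And A B)" "image_mset (wit_at F) X = {#Tensor t s#}"
        "\<forall>n\<in>#X. \<exists>w. occurs F n (WitS w)" using open_expansion[OF _ i(2)] S(2) i(1) by auto
    then obtain n where n: "X = {#n#}" "wit_at F n = Tensor t s" by (auto dest!: msed_map_invR)
    then have occ_n: "occurs F n (WitS (Tensor t s))" using X wit_at by fastforce
    note kids = children_simps(6)[OF occ_n] and occ = occurs_children(4)[OF occ_n]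
    define V1 where "V1 = S1 + {#Whole (Succ n LeftS) A#}"
    define V2 where "V2 = S2 + {#Whole (Succ n RightS) B#}"
    have tV: "tops (V1 + V2) = tops S' + children F n" unfolding V1_def V2_def kids eq by simp
    have sl: "slice F (V1 + V2)"
    proof -
      have "slice F (S' + {#Whole (Succ n LeftS) A, Whole (Succ n RightS) B#})"
      proof (rule slice_replace)
        show "slice F (S' + {#i#})" using S(1) i by simp
        show "item_ok F j" if "j \<in># {#Whole (Succ n LeftS) A, Whole (Succ n RightS) B#}" for j
          using that occ by auto
        show "covers (tops {#Whole (Succ n LeftS) A, Whole (Succ n RightS) B#}) m \<le> covers (tops {#i#}) m" for m
          using covers_children[of F n m] X n unfolding kids by simp
      qed
      then show ?thesis unfolding V1_def V2_def eq by (simp add: add_mset_commute)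
    qed
    then have sl': "slice F V1" "slice F V2" using slice_sub by blast+
    have seq: "sequent F V1 = G + {#TreeM t A#}" "sequent F V2 = H + {#TreeM s B#}"
      using eq occ by (auto simp: V1_def V2_def tree_at)
    let ?R1 = "over F (tops V1)" and ?R2 = "over F (tops V2)"
    have sep: "\<not> linked F a b" if "a \<in> ?R1" "b \<in> ?R2" for a b
      by (rule not_linked_if_disjoint_slices[OF sl _ _ that])
        (use seq and.hyps(3) LK_e_wires_dual[OF and.hyps(1)] in auto)
    have dis: "?R1 \<inter> ?R2 = {}" using over_disjoint[of "tops V1" "tops V2" F] slice_covers[OF sl] by simp
    have ac: "acyclic_on F (?R1 \<union> ?R2)"
      using acyclic_on_union[OF _ _ sep] and.IH sl' seq acyclic_slicesD by blast
    have sub: "over F (tops S) \<subseteq> insert n (?R1 \<union> ?R2)"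
      using over_children[of F n] i X n unfolding kids eq V1_def V2_def by auto
    have inR: "Succ n LeftS \<in> ?R1" "Succ n RightS \<in> ?R2"
      using occ anc_refl occurs_nodes by (auto simp: V1_def V2_def below_def)
    have n_link: "a = Succ n LeftS \<or> a = Succ n RightS" if "linked F a n" "a \<in> over F (tops S)" for a
    proof -
      have "a \<in> successors F n"
        using linked_top_no_wire[OF slice_covers[OF S(1)] _ that(2,1) occ_n] i X n by simp
      then show ?thesis using arg_cong[OF kids, of set_mset] by simp
    qed
    have R_sub: "?R1 \<union> ?R2 \<subseteq> over F (tops S)"
    proof -
      have "over F {#Succ n LeftS, Succ n RightS#} \<subseteq> over F {#n#}"
        using over_mono[OF covers_children[of F n]] unfolding kids .
      then show ?thesis unfolding V1_def V2_def i eq X n by auto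
    qed
    have "acyclic_on F (insert n (?R1 \<union> ?R2))"
    proof (rule acyclic_on_bridge[OF ac sep])
      show "a = b" if "a \<in> ?R1" "b \<in> ?R1" "linked F a n" "linked F b n" for a b
        using that n_link R_sub dis inR by blast
      show "a = b" if "a \<in> ?R2" "b \<in> ?R2" "linked F a n" "linked F b n" for a b
        using that n_link R_sub dis inR by blast
    qed
    then show "acyclic_on F (over F (tops S))" using sub acyclic_on_mono by blast
  qed
next
  case (contraction G M C N)
  show ?case
  proof (rule acyclic_slicesI)
    fix S assume S: "slice F S" "\<forall>i\<in>#S. is_open F i" "sequent F S = G + {#TreeM (Exp (M + N)) C#}"
    then obtain i S' where i: "S = add_mset i S'" "item_member F i = TreeM (Exp (M + N)) C" "sequent F S' = G"
      using sequent_add by (metis add_mset_add_single)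
    obtain X where X: "i = Part X C" "image_mset (wit_at F) X = M + N"
        "\<forall>n\<in>#X. \<exists>w. occurs F n (WitS w)" using open_expansion[OF _ i(2)] S(2) i(1) by auto
    then obtain X1 X2 where eq: "X = X1 + X2" "image_mset (wit_at F) X1 = M" "image_mset (wit_at F) X2 = N"
      by (metis image_mset_eq_plusD)
    have "slice F (S' + {#Part X1 C, Part X2 C#})"
    proof (rule slice_replace)
      show "slice F (S' + {#i#})" using S(1) i by simp
      show "item_ok F j" if "j \<in># {#Part X1 C, Part X2 C#}" for j using that X eq by auto
      show "covers (tops {#Part X1 C, Part X2 C#}) m \<le> covers (tops {#i#}) m" for m using X eq by simp
    qed
    moreover have "sequent F (S' + {#Part X1 C, Part X2 C#}) = G + {#TreeM (Exp M) C, TreeM (Exp N) C#}"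
      using i eq by simp
    ultimately have "acyclic_on F (over F (tops (S' + {#Part X1 C, Part X2 C#})))"
      using contraction.IH acyclic_slicesD by blast
    then show "acyclic_on F (over F (tops S))" using i X eq by (simp add: Un_commute Un_left_commute Un_assoc)
  qed
qed

section \<open>Typed sequents\<close>

inductive_cases typed_ExpE: "typed_tree \<Gamma> (Exp M) C"
inductive_cases typed_DisjE: "typed_tree \<Gamma> (Disj t s) C"
inductive_cases typed_OrLE: "typed_tree \<Gamma> (OrL t) C"
inductive_cases typed_OrRE: "typed_tree \<Gamma> (OrR t) C"
inductive_cases typed_WireE: "typed_wit \<Gamma> (Wire v) W"
inductive_cases typed_TensorE: "typed_wit \<Gamma> (Tensor t s) W"

definition typed_sequent :: "('x \<Rightarrow> 'a) \<Rightarrow> ('a, 'x) forest \<Rightarrow> bool" where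
  "typed_sequent \<Gamma> H \<longleftrightarrow> (\<forall>m\<in>#H. \<exists>t A. m = TreeM t A \<and> typed_tree \<Gamma> t A)"

lemma typed_sequent_simps [simp]:
  "typed_sequent \<Gamma> {#}"
  "typed_sequent \<Gamma> (G + H) \<longleftrightarrow> typed_sequent \<Gamma> G \<and> typed_sequent \<Gamma> H"
  "typed_sequent \<Gamma> (add_mset m H) \<longleftrightarrow> (\<exists>t A. m = TreeM t A \<and> typed_tree \<Gamma> t A) \<and> typed_sequent \<Gamma> H"
  by (auto simp: typed_sequent_def)

lemma e_annotated_sequent_iff:
  "e_annotated_sequent H \<longleftrightarrow> H \<noteq> {#} \<and> (\<exists>\<Gamma>. typed_sequent \<Gamma> H) \<and>
     (\<forall>v. count (wires H) v \<le> 1) \<and> (\<forall>x. PosW x \<in># wires H \<longleftrightarrow> NegW x \<in># wires H)"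
proof -
  have "(\<forall>m\<in>#H. typed_member \<Gamma> m) \<and> (\<forall>m\<in>#H. \<exists>t A. m = TreeM t A) \<longleftrightarrow> typed_sequent \<Gamma> H" for \<Gamma>
    unfolding typed_sequent_def by fastforce
  then show ?thesis unfolding e_annotated_sequent_def typed_forest_def by blast
qed

lemma e_annotated_replace:
  assumes "e_annotated_sequent (H + U)" "wires V = wires U" "V \<noteq> {#}"
    "\<And>\<Gamma>. typed_sequent \<Gamma> U \<Longrightarrow> typed_sequent \<Gamma> V"
  shows "e_annotated_sequent (H + V)"
  using assms unfolding e_annotated_sequent_iff by auto

text \<open>
  At inner nodes, types guarantee that expansions are nonempty, so that switchings exist.
\<close>
lemma typed_occurs:
  assumes "\<forall>m\<in>#F. typed_member \<Gamma> m" "occurs F n u"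
  shows "(\<forall>t. u = TreeS t \<longrightarrow> (\<exists>A. typed_tree \<Gamma> t A)) \<and> (\<forall>w. u = WitS w \<longrightarrow> (\<exists>W. typed_wit \<Gamma> w W))"
  using assms(2)
proof (induction rule: occurs.induct)
  case (1 k m)
  then have "m \<in># F" by (metis count_inI not_less_zero)
  then have "typed_member \<Gamma> m" using assms(1) by blast
  then show ?case by (cases m) auto
next
  case (2 n u s v)
  from 2(2,3) show ?case
  proof (cases rule: child.cases)
    case (9 k M w)
    then have "w \<in># M" by (metis count_inI not_less_zero)
    then show ?thesis using 2(3) 9 by (auto elim!: typed_ExpE)
  qed (auto elim!: typed_DisjE typed_OrLE typed_OrRE typed_TensorE)
qed

lemma switched_successors:
  assumes "e_annotated_sequent F" "switched F n"
  shows "successors F n \<noteq> {}"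
proof -
  obtain \<Gamma> where ty: "\<forall>m\<in>#F. typed_member \<Gamma> m"
    using assms(1) unfolding e_annotated_sequent_def typed_forest_def by blast
  consider (exp) M where "occurs F n (TreeS (Exp M))" | (disj) t s where "occurs F n (TreeS (Disj t s))"
    using assms(2) unfolding switched_def by blast
  then show ?thesis
  proof cases
    case exp
    then obtain A where "typed_tree \<Gamma> (Exp M) A" using typed_occurs[OF ty] by blast
    then have "M \<noteq> {#}" by (auto elim: typed_ExpE)
    then obtain w where "w \<in># M" by (meson multiset_nonemptyE)
    then have "Succ n (SummandS w 0) \<in> successors F n" unfolding successors_Exp[OF exp] by auto
    then show ?thesis by blast
  next
    case disj
    then show ?thesis by (auto simp: successors_of child_cases)
  qed
qed

section \<open>Weights\<close>

text \<open>
  The weight drops from the conclusion to each premiss of the rules for conjunction and disjunction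
  and of contraction. For contraction it drops because \<open>1\<close> is subtracted from each sum: two
  expansions together weigh less than their sum. The subtraction never truncates on nonempty
  sums, because a witness weighs at least \<open>2\<close>.
\<close>
primrec tree_weight :: "'x tree \<Rightarrow> nat" and wit_weight :: "'x wit \<Rightarrow> nat" where
  "tree_weight One = 1"
| "tree_weight (Exp M) = sum_mset (image_mset wit_weight M) - 1"
| "tree_weight (Disj t s) = tree_weight t + tree_weight s + 1"
| "tree_weight (OrL t) = tree_weight t + 1"
| "tree_weight (OrR t) = tree_weight t + 1"
| "wit_weight (Wire v) = 2"
| "wit_weight (Tensor t s) = tree_weight t + tree_weight s + 2"

fun member_weight :: "('a, 'x) member \<Rightarrow> nat" where
  "member_weight (TreeM t A) = tree_weight t"
| "member_weight (WitM w W) = wit_weight w"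

abbreviation weight :: "('a, 'x) forest \<Rightarrow> nat" where
  "weight H \<equiv> sum_mset (image_mset member_weight H)"

lemma wit_weight_pos: "wit_weight w \<ge> 2"
  by (cases w) auto

lemma sum_weight_pos: "M \<noteq> {#} \<Longrightarrow> sum_mset (image_mset wit_weight M) \<ge> 2"
  using wit_weight_pos by (cases M) (auto intro: trans_le_add1)

lemma weight_split:
  "M \<noteq> {#} \<Longrightarrow> N \<noteq> {#} \<Longrightarrow> tree_weight (Exp M) + tree_weight (Exp N) < tree_weight (Exp (M + N))"
  using sum_weight_pos[of M] sum_weight_pos[of N] by simp

section \<open>Sequents without tensors\<close>

text \<open>
  The wires occur in dual pairs, and typing in a common context gives the two ends of a wire the types
  that the identity axiom requires.
\<close>
lemma LK_e_axioms:
  assumes "e_annotated_sequent H"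
    and "\<And>t A. TreeM t A \<in># H \<Longrightarrow> t = One \<or> (\<exists>v. t = Exp {#Wire v#})"
  shows "LK_e H"
  using assms
proof (induction "size H" arbitrary: H rule: less_induct)
  case less
  note ann = less.prems(1)[unfolded e_annotated_sequent_iff]
  obtain \<Gamma> where ty: "typed_sequent \<Gamma> H" using ann by blast
  then have mem: "\<exists>t A. m = TreeM t A \<and> typed_tree \<Gamma> t A" if "m \<in># H" for m
    using that by (auto simp: typed_sequent_def)
  show ?case
  proof (cases "\<exists>x. PosW x \<in># wires H")
    case False
    then have "NegW x \<notin># wires H" for x using ann by blast
    with False have "v \<notin># wires H" for v by (cases v) auto
    then have no_wires: "wires H = {#}" by blast
    obtain m where m: "m \<in># H" using ann by blast
    then obtain H' where H: "H = add_mset m H'" by (meson multi_member_split)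
    obtain t A where t: "m = TreeM t A" "typed_tree \<Gamma> t A" using mem m by blast
    have "t = One" using less.prems(2)[of t A] m t no_wires H by auto
    moreover have "A = Top" using t(2) \<open>t = One\<close> by (auto elim: typed_tree.cases)
    ultimately have m_eq: "m = TreeM One Top" using t by simp
    show ?thesis
    proof (cases "H' = {#}")
      case True
      then show ?thesis using H m_eq LK_e.top_ax by simp
    next
      case False
      have "e_annotated_sequent H'" unfolding e_annotated_sequent_iff
        using False ty no_wires H by auto
      then have "LK_e H'" using less.hyps[of H'] less.prems(2) H by auto
      then have "LK_e ({#TreeM One Top#} + H')"
        by (intro LK_e.mix LK_e.top_ax) (auto simp: wires_def)
      then show ?thesis using H m_eq by simp
    qed
  next
    case True
    then obtain x where x: "PosW x \<in># wires H" "NegW x \<in># wires H" using ann by blast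
    have find: "\<exists>A. TreeM (Exp {#Wire v#}) A \<in># H \<and> typed_tree \<Gamma> (Exp {#Wire v#}) A" if v: "v \<in># wires H" for v
    proof -
      obtain m where m: "m \<in># H" "v \<in># wires_member m" using v by (auto simp: wires_def)
      then obtain t A where t: "m = TreeM t A" "typed_tree \<Gamma> t A" using mem by blast
      then have "t = One \<or> (\<exists>v. t = Exp {#Wire v#})" using less.prems(2) m by blast
      then have "t = Exp {#Wire v#}" using m(2) t(1) by auto
      then show ?thesis using m t by blast
    qed
    obtain A where A: "TreeM (Exp {#Wire (PosW x)#}) A \<in># H" "typed_tree \<Gamma> (Exp {#Wire (PosW x)#}) A"
      using find[OF x(1)] by blast
    obtain B where B: "TreeM (Exp {#Wire (NegW x)#}) B \<in># H" "typed_tree \<Gamma> (Exp {#Wire (NegW x)#}) B"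
      using find[OF x(2)] by blast
    have AB: "A = Atom (\<Gamma> x)" "B = NAtom (\<Gamma> x)"
      using A(2) B(2) by (auto elim!: typed_ExpE typed_WireE)
    define P where "P = {#TreeM (Exp {#Wire (NegW x)#}) (NAtom (\<Gamma> x)), TreeM (Exp {#Wire (PosW x)#}) (Atom (\<Gamma> x))#}"
    have LKP: "LK_e P" unfolding P_def by (rule LK_e.id_ax)
    obtain H' where H: "H = P + H'"
    proof -
      obtain H1 where H1: "H = add_mset (TreeM (Exp {#Wire (PosW x)#}) A) H1" using A(1) by (meson multi_member_split)
      then have "TreeM (Exp {#Wire (NegW x)#}) B \<in># H1" using B(1) by auto
      then obtain H2 where "H1 = add_mset (TreeM (Exp {#Wire (NegW x)#}) B) H2" by (meson multi_member_split)
      then show ?thesis using that[of H2] H1 AB unfolding P_def by (simp add: add_mset_commute)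
    qed
    have wP: "wires P = {#PosW x, NegW x#}" by (simp add: P_def)
    have wH: "wires H = {#PosW x, NegW x#} + wires H'" by (simp add: H wP)
    have c: "count (wires H) v \<le> 1" for v using ann by blast
    have gone: "PosW x \<notin># wires H'" "NegW x \<notin># wires H'"
      using c[of "PosW x"] c[of "NegW x"] unfolding wH by (auto simp: not_in_iff)
    show ?thesis
    proof (cases "H' = {#}")
      case True
      then show ?thesis using LKP H by simp
    next
      case False
      have "PosW y \<in># wires H' \<longleftrightarrow> NegW y \<in># wires H'" for y
      proof (cases "y = x")
        case False
        have "PosW y \<in># wires H \<longleftrightarrow> NegW y \<in># wires H" using ann by blast
        then show ?thesis using False unfolding wH by simp
      qed (use gone in simp)
      moreover have "count (wires H') v \<le> 1" for v using c[of v] unfolding H by simp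
      ultimately have "e_annotated_sequent H'" unfolding e_annotated_sequent_iff using False ty H by auto
      then have "LK_e H'" using less.hyps[of H'] less.prems(2) H by (auto simp: P_def)
      then have "LK_e (P + H')" using LKP by (intro LK_e.mix) (use gone wP in auto)
      then show ?thesis using H by simp
    qed
  qed
qed

section \<open>Splitting tensors\<close>

text \<open>
  From a node to an ancestor there is a path on which each node is left towards its predecessor. It is
  cusp-free, and even forced in the sense of \<open>forced_path_avoided\<close>, because the edge from a node to its
  predecessor shares its colour with no other edge at that node.
\<close>
lemma descending_path:
  assumes "x \<in> anc k" "k \<in> nodes F" "k \<noteq> x"
  shows "\<exists>ds. successively (\<lambda>a b. a \<in> successors F b) (k # ds @ [x]) \<and> set (k # ds @ [x]) \<subseteq> below F x"
  using assms
proof (induction k)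
  case (Succ m s)
  have m: "m \<in> nodes F" "Succ m s \<in> successors F m" using Succ.prems
    by (auto simp: successors_Succ anc_refl intro: anc_nodes)
  have x: "x \<in> anc m" using Succ.prems by simp
  have k: "Succ m s \<in> below F x" using Succ.prems by (simp add: below_def)
  show ?case
  proof (cases "m = x")
    case True
    then show ?thesis using m k by (intro exI[of _ "[]"]) (auto simp: below_def anc_refl)
  next
    case False
    then obtain ds where "successively (\<lambda>a b. a \<in> successors F b) (m # ds @ [x])" "set (m # ds @ [x]) \<subseteq> below F x"
      using Succ.IH m x by blast
    then show ?thesis using m k by (intro exI[of _ "m # ds"]) auto
  qed
qed simp

lemma descending_distinct:
  assumes "successively (\<lambda>a b. a \<in> successors F b) ps"
  shows "distinct ps"
proof -
  have "successively (\<lambda>a b. size b < size a) ps"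
    using assms by (rule successively_mono) (auto simp: successors_Succ)
  then have "sorted_wrt (\<lambda>a b. size b < size a) ps"
    by (subst (asm) successively_conv_sorted_wrt) (auto simp: transp_def)
  then show ?thesis by (induction ps) auto
qed

lemma not_same_class_parent:
  assumes "v \<in> successors F p" "same_class F v p y"
  shows "y = p"
  using assms successors_asym unfolding same_class_def by blast

lemma descending_free:
  assumes "successively (\<lambda>a b. a \<in> successors F b) ps" "set ps \<subseteq> R"
  shows "region.cusp_free F R ps"
  unfolding region.cusp_free_def region.cusps_eq_0_iff
proof (intro conjI allI impI)
  have R: "ps ! i \<in> R" if "i < length ps" for i using assms(2) that by auto
  have s: "ps ! i \<in> successors F (ps ! Suc i)" if "Suc i < length ps" for i
    using successively_nth[OF assms(1) that] .
  show "successively (linked_in F R) ps" unfolding successively_conv_nth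
    using R s by (auto simp: linked_in_def linked_iff)
  fix i assume i: "Suc (Suc i) < length ps"
  show "\<not> same_class F (ps ! Suc i) (ps ! i) (ps ! Suc (Suc i))"
  proof
    assume "same_class F (ps ! Suc i) (ps ! i) (ps ! Suc (Suc i))"
    then have "ps ! i = ps ! Suc (Suc i)"
      using not_same_class_parent[OF s[OF i]] region.same_sym by blast
    then show False using descending_distinct[OF assms(1)] i by (simp add: nth_eq_iff_index_eq)
  qed
qed

lemma connected_walk:
  assumes "P\<^sup>*\<^sup>* a b"
  shows "\<exists>xs. successively P (a # xs) \<and> distinct (a # xs) \<and> last (a # xs) = b"
  using assms
proof (induction rule: rtranclp_induct)
  case base
  show ?case by (intro exI[of _ "[]"]) simp
next
  case (step b c)
  then obtain xs where xs: "successively P (a # xs)" "distinct (a # xs)" "last (a # xs) = b" by blast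
  show ?case
  proof (cases "c \<in> set (a # xs)")
    case True
    then obtain as bs where e: "a # xs = as @ c # bs" by (meson split_list)
    then have "successively P (as @ [c])" "distinct (as @ [c])"
      using xs by (auto simp: successively_append_iff)
    moreover obtain ys where "as @ [c] = a # ys" using e by (cases as) auto
    ultimately show ?thesis by (metis last_snoc)
  next
    case False
    have "successively P ((a # xs) @ [c])" using xs step by (subst successively_append_iff) simp
    then show ?thesis using xs False by (intro exI[of _ "xs @ [c]"]) auto
  qed
qed

text \<open>
  The members that the unary rules cannot decompose.
\<close>
definition terminal_item :: "('a, 'x) forest \<Rightarrow> ('a, 'x) item \<Rightarrow> bool" where
  "terminal_item F i \<longleftrightarrow> (\<exists>n C. i = Whole n C \<and> occurs F n (TreeS One)) \<or>
     (\<exists>n C w. i = Part {#n#} C \<and> occurs F n (WitS w))"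

lemma terminal_top:
  assumes "terminal_item F i"
  obtains n where "item_tops i = {#n#}" "\<not> switched F n"
proof -
  consider n C where "i = Whole n C" "occurs F n (TreeS One)" | n C w where "i = Part {#n#} C" "occurs F n (WitS w)"
    using assms unfolding terminal_item_def by blast
  then show ?thesis
  proof cases
    case (1 n C)
    then show ?thesis using that switched_iff[OF 1(2)] by simp
  next
    case (2 n C w)
    then show ?thesis using that switched_iff[OF 2(2)] by simp
  qed
qed

text \<open>
  Below a switched node the path towards the root ends in the top node of an item. Where every item
  is terminal, this top node has a successor, and so it is a tensor. Tensors are not switched, and
  they can serve as the set \<open>W\<close> of \<open>splitting_vertex\<close>.
\<close>
lemma splitting_tensor:
  assumes ac: "acyclic_on F (over F (tops S))"
    and terminal: "\<And>i. i \<in># S \<Longrightarrow> terminal_item F i"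
    and ex: "Part {#n0#} C0 \<in># S" "occurs F n0 (WitS (Tensor t0 s0))"
  shows "\<exists>n C t s. Part {#n#} C \<in># S \<and> occurs F n (WitS (Tensor t s)) \<and>
    (\<nexists>xs. successively (linked_in F (over F (tops S))) (n # xs @ [n]) \<and> distinct (n # xs) \<and> 2 \<le> length xs)"
proof -
  let ?R = "over F (tops S)"
  define W where "W = {n. \<exists>C t s. Part {#n#} C \<in># S \<and> occurs F n (WitS (Tensor t s))}"
  have "\<exists>w\<in>W. \<nexists>xs. successively (linked_in F ?R) (w # xs @ [w]) \<and> distinct (w # xs) \<and> 2 \<le> length xs"
  proof (rule region.splitting_vertex)
    show "\<not> region.cusp_free_cycle F ?R c" for c using ac by (simp add: acyclic_on_def)
    show "finite {v. \<exists>u. linked_in F ?R v u}"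
      by (rule finite_subset[OF _ finite_nodes[of F]]) (use over_nodes in \<open>auto simp: linked_in_def\<close>)
    show "W \<noteq> {}" using ex by (auto simp: W_def)
    show "a = b" if w: "w \<in> W" and s: "same_class F w a b" for w a b
    proof -
      obtain t s where "occurs F w (WitS (Tensor t s))" using w by (auto simp: W_def)
      from switched_iff[OF this] s show ?thesis by (simp add: same_class_def)
    qed
    fix k a b
    assume k: "same_class F k a b" "a \<noteq> b" "linked_in F ?R k a" "linked_in F ?R k b"
    have sw: "switched F k" "a \<in> successors F k" using k by (auto simp: same_class_def)
    have kR: "k \<in> ?R" using k by (simp add: linked_in_def)
    then obtain i x where i: "i \<in># S" "x \<in># item_tops i" "k \<in> below F x" by (auto simp: over_def)
    obtain n where n: "item_tops i = {#n#}" "\<not> switched F n" using terminal_top[OF terminal[OF i(1)]] .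
    have x: "item_tops i = {#x#}" "k \<noteq> x" using n i sw by auto
    have kx: "x \<in> anc k" "k \<in> nodes F" using i by (auto simp: below_def)
    have "x \<in># tops S" using i(1,2) by auto
    then have x_below: "below F x \<subseteq> ?R" unfolding over_def by blast
    obtain ds where ds: "successively (\<lambda>a b. a \<in> successors F b) (k # ds @ [x])"
      "set (k # ds @ [x]) \<subseteq> below F x" using descending_path[OF kx x(2)] by blast
    have last: "successors F x \<noteq> {}"
      using successively_nth[OF ds(1), of "length ds"] by (auto simp: nth_append)
    have "x \<in> W"
    proof -
      have "(\<exists>C. i = Whole x C \<and> occurs F x (TreeS One)) \<or> (\<exists>C w. i = Part {#x#} C \<and> occurs F x (WitS w))"
        using terminal[OF i(1)] x(1) unfolding terminal_item_def by auto
      moreover have "\<not> occurs F x (TreeS One)" "\<not> occurs F x (WitS (Wire v))" for v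
        using last by (auto simp: successors_of child_cases)
      ultimately obtain C w where w: "i = Part {#x#} C" "occurs F x (WitS w)" by blast
      then obtain t s where "w = Tensor t s" using \<open>\<And>v. \<not> occurs F x (WitS (Wire v))\<close> by (cases w) auto
      then show ?thesis using w i(1) by (auto simp: W_def)
    qed
    moreover have "set (k # ds @ [x]) \<subseteq> ?R" using ds(2) x_below by blast
    moreover have "\<not> same_class F k a (hd (ds @ [x]))"
    proof
      have p: "k \<in> successors F (hd (ds @ [x]))" using ds(1) by (cases ds) auto
      assume "same_class F k a (hd (ds @ [x]))"
      then have "a = hd (ds @ [x])" using not_same_class_parent[OF p] region.same_sym by blast
      then show False using p sw(2) successors_asym by blast
    qed
    moreover have "y = hd (d2 @ [x])"
      if e: "k # ds = d1 @ z # d2" and s: "same_class F z (hd (d2 @ [x])) y" for d1 z d2 y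
    proof -
      have "successively (\<lambda>a b. a \<in> successors F b) (d1 @ z # (d2 @ [x]))"
        using ds(1) unfolding append_Cons[symmetric] append_assoc[symmetric] e[symmetric] .
      then have "z \<in> successors F (hd (d2 @ [x]))" by (cases d2) (auto simp: successively_append_iff)
      then show ?thesis using s by (rule not_same_class_parent)
    qed
    ultimately show "\<exists>ds w. w \<in> W \<and> region.cusp_free F ?R (k # ds @ [w]) \<and> distinct (k # ds @ [w]) \<and>
        \<not> same_class F k a (hd (ds @ [w])) \<and>
        (\<forall>d1 z d2 y. k # ds = d1 @ z # d2 \<longrightarrow> same_class F z (hd (d2 @ [w])) y \<longrightarrow> y = hd (d2 @ [w]))"
      using descending_free[OF ds(1)] descending_distinct[OF ds(1)]
      by (intro exI[of _ ds] exI[of _ x] conjI) blast+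
  qed
  then show ?thesis by (auto simp: W_def)
qed

lemma walk_within: "successively (linked_in F R) xs \<Longrightarrow> 2 \<le> length xs \<Longrightarrow> set xs \<subseteq> R"
proof (induction xs rule: induct_list012)
  case (3 x y zs)
  then show ?case by (cases zs) (auto simp: linked_in_def)
qed auto

lemma no_cycle_separates:
  assumes noc: "\<nexists>xs. successively (linked_in F R) (n # xs @ [n]) \<and> distinct (n # xs) \<and> 2 \<le> length xs"
    and ab: "linked_in F R n a" "linked_in F R n b" "a \<noteq> b"
  shows "\<not> (linked_in F (R - {n}))\<^sup>*\<^sup>* a b"
proof
  assume c: "(linked_in F (R - {n}))\<^sup>*\<^sup>* a b"
  obtain xs where xs: "successively (linked_in F (R - {n})) (a # xs)" "distinct (a # xs)" "last (a # xs) = b"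
    using connected_walk[OF c] by blast
  have ne: "xs \<noteq> []" using xs ab(3) by auto
  have "n \<notin> set (a # xs)" using walk_within[OF xs(1)] ne by (cases xs) auto
  then have "distinct (n # a # xs)" using xs by simp
  moreover have w: "successively (linked_in F R) (a # xs)"
    using xs(1) by (rule successively_mono) (auto simp: linked_in_def)
  moreover have "linked_in F R b n" using ab by (auto simp: linked_in_def intro: linked_sym)
  then have "successively (linked_in F R) ((a # xs) @ [n])"
    using w xs(3) by (subst successively_append_iff) simp
  then have "successively (linked_in F R) (n # (a # xs) @ [n])" using ab(1) by simp
  moreover have "2 \<le> length (a # xs)" using ne by (cases xs) auto
  ultimately show False using noc by blast
qed

text \<open>
  The remaining items are divided according to whether they are connected to the left argument of
  the tensor when the tensor node is removed. Each item is on one side as a whole, since a terminal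
  item has a single top and its subtree is connected.
\<close>
lemma splitting_partition:
  assumes S: "slice F (add_mset (Part {#n#} C) S0)"
    and n: "occurs F n (WitS (Tensor t s))"
    and terminal: "\<And>i. i \<in># S0 \<Longrightarrow> terminal_item F i"
    and noc: "\<nexists>xs. successively (linked_in F (over F (tops (add_mset (Part {#n#} C) S0)))) (n # xs @ [n]) \<and>
      distinct (n # xs) \<and> 2 \<le> length xs"
  obtains S1 S2 where "S0 = S1 + S2"
    "\<And>u v. u \<in> over F (add_mset (Succ n LeftS) (tops S1)) \<Longrightarrow>
      v \<in> over F (add_mset (Succ n RightS) (tops S2)) \<Longrightarrow> \<not> linked F u v"
proof -
  let ?l = "Succ n LeftS" and ?r = "Succ n RightS"
  let ?S = "add_mset (Part {#n#} C) S0"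
  let ?R = "over F (tops ?S)"
  note kids = children_simps(6)[OF n]
  have cov: "\<forall>m. covers (tops ?S) m \<le> 1" using slice_covers[OF S] .
  have succ: "successors F n = {?l, ?r}" using arg_cong[OF kids, of set_mset] by simp
  have nR: "n \<in> ?R" using occurs_nodes[OF n] by (simp add: below_def anc_refl)
  have lR: "?l \<in> ?R" "?r \<in> ?R" using over_successors[OF nR] succ by auto
  have link: "linked_in F ?R n ?l" "linked_in F ?R n ?r"
    using nR lR succ by (auto simp: linked_in_def linked_iff)
  define K where "K = {y. (linked_in F (?R - {n}))\<^sup>*\<^sup>* ?l y}"
  have r: "?r \<notin> K" using no_cycle_separates[OF noc link] by (simp add: K_def)
  have Kstep: "v \<in> K \<longleftrightarrow> u \<in> K" if uv: "u \<in> ?R - {n}" "v \<in> ?R - {n}" "linked F u v" for u v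
  proof -
    have "linked_in F (?R - {n}) u v" "linked_in F (?R - {n}) v u"
      using uv linked_sym by (auto simp: linked_in_def)
    then show ?thesis unfolding K_def by (auto intro: rtranclp.rtrancl_into_rtrancl)
  qed
  have Kbelow: "y \<in> K \<longleftrightarrow> x \<in> K" if sub: "below F x \<subseteq> ?R - {n}" and y: "y \<in> below F x" for x y
    using y
  proof (induction y)
    case (Root m k)
    then show ?case by (auto simp: below_def)
  next
    case (Succ m k)
    show ?case
    proof (cases "x = Succ m k")
      case False
      then have x: "x \<in> anc m" "Succ m k \<in> nodes F" using Succ.prems by (auto simp: below_def)
      then have m: "m \<in> below F x" by (auto simp: below_def anc_refl intro: anc_nodes)
      have "linked F m (Succ m k)" using x by (auto simp: linked_iff successors_Succ)
      then show ?thesis using Kstep[of m "Succ m k"] m Succ sub by blast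
    qed simp
  qed
  have sub_child: "below F c \<subseteq> ?R - {n}" if c: "c \<in> successors F n" for c
  proof -
    obtain k where k: "c = Succ n k" using c by (auto simp: successors_Succ)
    have "n \<in> anc m" "m \<noteq> n" if "m \<in> below F c" for m
      using that k Succ_not_anc[of n k] anc_trans[of n c m] anc_refl by (auto simp: below_def)
    then show ?thesis by (auto simp: below_def)
  qed
  define P where "P i \<longleftrightarrow> set_mset (item_tops i) \<subseteq> K" for i :: "('a, 'b) item"
  define S1 where "S1 = filter_mset P S0"
  define S2 where "S2 = filter_mset (\<lambda>i. \<not> P i) S0"
  have eq: "S0 = S1 + S2" unfolding S1_def S2_def by (rule multiset_partition)
  have item: "over F (item_tops i) \<subseteq> ?R - {n} \<and>
      (if P i then over F (item_tops i) \<subseteq> K else over F (item_tops i) \<inter> K = {})" if i: "i \<in># S0" for i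
  proof -
    obtain x where x: "item_tops i = {#x#}" using terminal_top[OF terminal[OF i]] by blast
    have "x \<in># tops S0" using i x by force
    then have "over F {#x#} \<subseteq> over F (tops S0)" by (auto simp: over_def)
    moreover have "over F {#n#} \<inter> over F (tops S0) = {}"
      using over_disjoint[of "{#n#}" "tops S0" F] cov by simp
    moreover have "n \<in> over F {#n#}" using occurs_nodes[OF n] by (simp add: below_def anc_refl)
    ultimately have sub: "below F x \<subseteq> ?R - {n}" by auto
    have "P i \<longleftrightarrow> x \<in> K" by (simp add: P_def x)
    then show ?thesis using sub Kbelow[OF sub] x by auto
  qed
  have over_tops: "m \<in> over F (tops U) \<longleftrightarrow> (\<exists>i\<in>#U. m \<in> over F (item_tops i))" for m U
    by (induction U) auto
  have l_below: "below F ?l \<subseteq> K \<inter> (?R - {n})"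
    using Kbelow[OF sub_child[of ?l]] sub_child[of ?l] succ by (auto simp: K_def)
  have r_below: "below F ?r \<subseteq> (?R - {n}) - K"
    using Kbelow[OF sub_child[of ?r]] sub_child[of ?r] succ r by auto
  have 1: "u \<in> K \<inter> (?R - {n})" if u: "u \<in> over F (add_mset ?l (tops S1))" for u
  proof (cases "u \<in> below F ?l")
    case False
    then obtain i where "i \<in># S1" "u \<in> over F (item_tops i)" using u over_tops by auto
    then show ?thesis using item[of i] by (auto simp: S1_def)
  qed (use l_below in blast)
  have 2: "v \<in> (?R - {n}) - K" if v: "v \<in> over F (add_mset ?r (tops S2))" for v
  proof (cases "v \<in> below F ?r")
    case False
    then obtain i where i: "i \<in># S2" "v \<in> over F (item_tops i)" using v over_tops by auto
    then show ?thesis using item[of i] by (auto simp: S2_def)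
  qed (use r_below in blast)
  show ?thesis
  proof (rule that[OF eq])
    fix u v assume "u \<in> over F (add_mset ?l (tops S1))" "v \<in> over F (add_mset ?r (tops S2))"
    then show "\<not> linked F u v" using 1 2 Kstep by blast
  qed
qed

section \<open>Slices without cusp-free cycles are derivable\<close>

text \<open>
  Dual ends of a wire are linked; so if two parts of a slice are not linked, each of them is closed
  under duality.
\<close>
lemma e_annotated_separated:
  assumes G: "e_annotated_sequent (sequent F (S1 + S2))"
    and ok: "\<And>i. i \<in># S1 + S2 \<Longrightarrow> item_ok F i"
    and sep: "\<And>u v. u \<in> over F (tops S1) \<Longrightarrow> v \<in> over F (tops S2) \<Longrightarrow> \<not> linked F u v"
    and ne: "S1 \<noteq> {#}"
  shows "e_annotated_sequent (sequent F S1)"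
proof -
  note ann = G[unfolded e_annotated_sequent_iff]
  have ok1: "\<forall>i\<in>#S1. item_ok F i" and ok2: "\<forall>i\<in>#S2. item_ok F i" using ok by auto
  have other: "w \<in># wires (sequent F S1)"
    if v: "v \<in># wires (sequent F S1)" and vw: "{v, w} = {PosW x, NegW x}" for v w x
  proof (rule ccontr)
    assume no: "w \<notin># wires (sequent F S1)"
    have "v \<in># wires (sequent F (S1 + S2))" using v by simp
    then have "w \<in># wires (sequent F (S1 + S2))" using ann vw by (auto simp: doubleton_eq_iff)
    then have "w \<in># wires (sequent F S2)" using no by simp
    then obtain b where b: "b \<in> over F (tops S2)" "occurs F b (WitS (Wire w))"
      using in_wires_sequent_iff[OF ok2] by blast
    obtain a where a: "a \<in> over F (tops S1)" "occurs F a (WitS (Wire v))"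
      using v in_wires_sequent_iff[OF ok1] by blast
    have "linked F a b" using a b vw by (auto simp: linked_iff axiom_link_def doubleton_eq_iff)
    then show False using sep a b by blast
  qed
  have "PosW x \<in># wires (sequent F S1) \<longleftrightarrow> NegW x \<in># wires (sequent F S1)" for x
    using other[of "PosW x" "NegW x" x] other[of "NegW x" "PosW x" x] by (auto simp: insert_commute)
  moreover have "count (wires (sequent F S1)) v \<le> 1" for v
  proof -
    have "count (wires (sequent F (S1 + S2))) v \<le> 1" using ann by blast
    then show ?thesis by simp
  qed
  ultimately show ?thesis using ann ne unfolding e_annotated_sequent_iff by auto
qed

text \<open>
  Every premiss is presented by a slice over a smaller or equal set of nodes, which inherits the
  absence of cusp-free cycles. For the unary rules this is the local fact \<open>replace\<close>; expansions lose one
  summand at a time.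
\<close>
lemma LK_e_if_acyclic:
  assumes "slice F S" "e_annotated_sequent (sequent F S)" "acyclic_on F (over F (tops S))"
  shows "LK_e (sequent F S)"
  using assms
proof (induction "weight (sequent F S)" arbitrary: S rule: less_induct)
  case less
  define T where "T = opened_items F S"
  have T: "slice F T" "sequent F T = sequent F S"
    using opened_items_slice[OF less.prems(1)] unfolding T_def by auto
  have acT: "acyclic_on F (over F (tops T))"
    using acyclic_on_mono[OF less.prems(3) opened_items_over] unfolding T_def .
  have annT: "e_annotated_sequent (sequent F T)" using T less.prems by simp
  have openT: "is_open F i" if "i \<in># T" for i
    using that opened_is_open slice_ok[OF less.prems(1)] unfolding T_def by auto
  have IH: "LK_e (sequent F U)"
    if "weight (sequent F U) < weight (sequent F T)" "slice F U" "e_annotated_sequent (sequent F U)"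
      "over F (tops U) \<subseteq> over F (tops T)" for U
    using less.hyps[of U] that acyclic_on_mono[OF acT] T(2) by simp
  have replace: "LK_e (sequent F U + sequent F V)"
    if i: "T = add_mset i U" and V: "V \<noteq> {#}" "\<And>j. j \<in># V \<Longrightarrow> item_ok F j"
      "\<And>m. covers (tops V) m \<le> covers (item_tops i) m"
      and w: "weight (sequent F V) < member_weight (item_member F i)"
        "wires (sequent F V) = wires_member (item_member F i)"
      and ty: "\<And>\<Gamma>. typed_sequent \<Gamma> {#item_member F i#} \<Longrightarrow> typed_sequent \<Gamma> (sequent F V)" for i U V
  proof -
    have "LK_e (sequent F (U + V))"
    proof (rule IH)
      show "weight (sequent F (U + V)) < weight (sequent F T)" using i w by simp
      show "slice F (U + V)" "over F (tops (U + V)) \<subseteq> over F (tops T)"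
        using slice_replace_top[OF T(1)[unfolded i] V(2,3)] unfolding i by auto
      have "e_annotated_sequent (sequent F U + sequent F V)"
        by (rule e_annotated_replace[of _ "{#item_member F i#}"]) (use annT i V w ty in auto)
      then show "e_annotated_sequent (sequent F (U + V))" by simp
    qed
    then show ?thesis by simp
  qed
  have "LK_e (sequent F T)"
  proof (cases "\<forall>i\<in>#T. terminal_item F i")
    case False
    then obtain i where i: "i \<in># T" "\<not> terminal_item F i" by blast
    then obtain U where U: "T = add_mset i U" by (meson multi_member_split)
    have ok: "item_ok F i" and op: "is_open F i" using slice_ok[OF T(1) i(1)] openT[OF i(1)] .
    obtain \<Gamma> where "typed_sequent \<Gamma> {#item_member F i#}"
      using annT U unfolding e_annotated_sequent_iff by auto
    then obtain t C where t: "item_member F i = TreeM t C" "typed_tree \<Gamma> t C" by auto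
    show ?thesis
    proof (cases t)
      case One
      then obtain n where "i = Whole n C" "occurs F n (TreeS One)" using whole_item[OF ok t(1)] by auto
      then show ?thesis using i by (simp add: terminal_item_def)
    next
      case (Exp M)
      obtain X where X: "i = Part X C" "image_mset (wit_at F) X = M" "\<forall>n\<in>#X. \<exists>w. occurs F n (WitS w)"
        using open_expansion[OF op t(1)[unfolded Exp]] .
      have "M \<noteq> {#}" using t(2) Exp by (auto elim: typed_ExpE)
      then obtain x Y where Y: "X = add_mset x Y" using X by (metis image_mset_empty multiset_cases)
      have "Y \<noteq> {#}" using i(2) X Y by (auto simp: terminal_item_def)
      let ?V = "{#Part {#x#} C, Part Y C#}"
      have M: "M = image_mset (wit_at F) {#x#} + image_mset (wit_at F) Y" using X Y by simp
      have "LK_e (sequent F U + sequent F ?V)"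
      proof (rule replace[OF U])
        show "?V \<noteq> {#}" by simp
        show "item_ok F j" if "j \<in># ?V" for j using that X Y by auto
        show "covers (tops ?V) m \<le> covers (item_tops i) m" for m using X Y by simp
        have "tree_weight (Exp (image_mset (wit_at F) {#x#})) + tree_weight (Exp (image_mset (wit_at F) Y)) <
            tree_weight (Exp M)"
          unfolding M by (rule weight_split) (use \<open>Y \<noteq> {#}\<close> in simp_all)
        then show "weight (sequent F ?V) < member_weight (item_member F i)" using t(1) Exp by simp
        show "wires (sequent F ?V) = wires_member (item_member F i)" unfolding t(1) Exp M by simp
        show "typed_sequent \<Delta> (sequent F ?V)" if "typed_sequent \<Delta> {#item_member F i#}" for \<Delta>
        proof -
          have "typed_tree \<Delta> (Exp M) C" using that t(1) Exp by simp
          then obtain W where W: "C = sum_type W" "\<forall>w\<in>#M. typed_wit \<Delta> w W" by (auto elim: typed_ExpE)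
          have "typed_tree \<Delta> (Exp (image_mset (wit_at F) Z)) C" if "Z \<noteq> {#}" "Z \<subseteq># X" for Z
            unfolding W(1) by (rule typed_tree_typed_wit.expansion)
              (use that W(2) X mset_subset_eqD[OF that(2)] in auto)
          from this[of "{#x#}"] this[of Y] show ?thesis using Y \<open>Y \<noteq> {#}\<close> by simp
        qed
      qed
      then have "LK_e (sequent F U + {#TreeM (Exp (image_mset (wit_at F) {#x#})) C, TreeM (Exp (image_mset (wit_at F) Y)) C#})"
        by simp
      moreover have "contractible C"
      proof -
        obtain W where "C = sum_type W" using t(2) Exp by (auto elim: typed_ExpE)
        then show ?thesis by (cases W) (auto simp: contractible_def)
      qed
      ultimately have "LK_e (sequent F U + {#TreeM (Exp (image_mset (wit_at F) {#x#} + image_mset (wit_at F) Y)) C#})"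
        by (rule LK_e.contraction)
      then show ?thesis using U t(1) Exp M by simp
    next
      case (Disj t1 t2)
      obtain n where n: "i = Whole n C" "occurs F n (TreeS (Disj t1 t2))" using whole_item[OF ok t(1)] Disj by auto
      note occ = occurs_children(1)[OF n(2)]
      obtain A B where AB: "C = Or A B" using t(2) Disj by (auto elim: typed_DisjE)
      let ?V = "{#Whole (Succ n LeftS) A, Whole (Succ n RightS) B#}"
      have seq: "sequent F ?V = {#TreeM t1 A, TreeM t2 B#}" using occ by (auto simp: tree_at)
      have "LK_e (sequent F U + sequent F ?V)"
      proof (rule replace[OF U])
        show "item_ok F j" if "j \<in># ?V" for j using that occ by auto
        show "covers (tops ?V) m \<le> covers (item_tops i) m" for m
          using covers_children[of F n m] n unfolding children_simps(3)[OF n(2)] by simp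
        show "weight (sequent F ?V) < member_weight (item_member F i)"
          "wires (sequent F ?V) = wires_member (item_member F i)" unfolding seq t(1) Disj by simp_all
        show "typed_sequent \<Delta> (sequent F ?V)" if "typed_sequent \<Delta> {#item_member F i#}" for \<Delta>
          using that unfolding seq t(1) Disj AB by (auto elim: typed_DisjE)
      qed simp
      then show ?thesis using LK_e.or[of "sequent F U" t1 A t2 B] U t(1) Disj AB unfolding seq by simp
    next
      case (OrL t1)
      obtain n where n: "i = Whole n C" "occurs F n (TreeS (OrL t1))" using whole_item[OF ok t(1)] OrL by auto
      note occ = occurs_children(2)[OF n(2)]
      obtain A B where AB: "C = Or A B" using t(2) OrL by (auto elim: typed_OrLE)
      let ?V = "{#Whole (Succ n LeftS) A#}"
      have seq: "sequent F ?V = {#TreeM t1 A#}" using occ by (auto simp: tree_at)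
      have "LK_e (sequent F U + sequent F ?V)"
      proof (rule replace[OF U])
        show "item_ok F j" if "j \<in># ?V" for j using that occ by auto
        show "covers (tops ?V) m \<le> covers (item_tops i) m" for m
          using covers_children[of F n m] n unfolding children_simps(4)[OF n(2)] by simp
        show "weight (sequent F ?V) < member_weight (item_member F i)"
          "wires (sequent F ?V) = wires_member (item_member F i)" unfolding seq t(1) OrL by simp_all
        show "typed_sequent \<Delta> (sequent F ?V)" if "typed_sequent \<Delta> {#item_member F i#}" for \<Delta>
          using that unfolding seq t(1) OrL AB by (auto elim: typed_OrLE)
      qed simp
      then show ?thesis using LK_e.or0[of "sequent F U" t1 A B] U t(1) OrL AB unfolding seq by simp
    next
      case (OrR t1)
      obtain n where n: "i = Whole n C" "occurs F n (TreeS (OrR t1))" using whole_item[OF ok t(1)] OrR by auto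
      note occ = occurs_children(3)[OF n(2)]
      obtain A B where AB: "C = Or A B" using t(2) OrR by (auto elim: typed_OrRE)
      let ?V = "{#Whole (Succ n RightS) B#}"
      have seq: "sequent F ?V = {#TreeM t1 B#}" using occ by (auto simp: tree_at)
      have "LK_e (sequent F U + sequent F ?V)"
      proof (rule replace[OF U])
        show "item_ok F j" if "j \<in># ?V" for j using that occ by auto
        show "covers (tops ?V) m \<le> covers (item_tops i) m" for m
          using covers_children[of F n m] n unfolding children_simps(5)[OF n(2)] by simp
        show "weight (sequent F ?V) < member_weight (item_member F i)"
          "wires (sequent F ?V) = wires_member (item_member F i)" unfolding seq t(1) OrR by simp_all
        show "typed_sequent \<Delta> (sequent F ?V)" if "typed_sequent \<Delta> {#item_member F i#}" for \<Delta>
          using that unfolding seq t(1) OrR AB by (auto elim: typed_OrRE)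
      qed simp
      then show ?thesis using LK_e.or1[of "sequent F U" t1 B A] U t(1) OrR AB unfolding seq by simp
    qed
  next
    case True
    then have terminal: "terminal_item F i" if "i \<in># T" for i using that by blast
    show ?thesis
    proof (cases "\<exists>n C t s. Part {#n#} C \<in># T \<and> occurs F n (WitS (Tensor t s))")
      case False
      show ?thesis
      proof (rule LK_e_axioms[OF annT])
        fix t A assume "TreeM t A \<in># sequent F T"
        then obtain i where i: "i \<in># T" "item_member F i = TreeM t A" by auto
        from terminal[OF i(1)] show "t = One \<or> (\<exists>v. t = Exp {#Wire v#})"
          unfolding terminal_item_def
        proof (elim disjE exE conjE)
          fix n C assume "i = Whole n C" "occurs F n (TreeS One)"
          then show ?thesis using i by (auto simp: tree_at)
        next
          fix n C w assume *: "i = Part {#n#} C" "occurs F n (WitS w)"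
          then obtain v where "w = Wire v" using False i by (cases w) auto
          then show ?thesis using i * by (auto simp: wit_at)
        qed
      qed
    next
      case True
      then obtain n0 C0 t0 s0 where "Part {#n0#} C0 \<in># T" "occurs F n0 (WitS (Tensor t0 s0))" by blast
      from splitting_tensor[OF acT terminal this] obtain n C t s where n: "Part {#n#} C \<in># T"
          "occurs F n (WitS (Tensor t s))"
        and noc: "\<nexists>xs. successively (linked_in F (over F (tops T))) (n # xs @ [n]) \<and> distinct (n # xs) \<and> 2 \<le> length xs"
        by blast
      obtain U where U: "T = add_mset (Part {#n#} C) U" using n(1) by (meson multi_member_split)
      obtain S1 S2 where S12: "U = S1 + S2"
        and sep: "\<And>u v. u \<in> over F (add_mset (Succ n LeftS) (tops S1)) \<Longrightarrow>
          v \<in> over F (add_mset (Succ n RightS) (tops S2)) \<Longrightarrow> \<not> linked F u v"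
      proof (rule splitting_partition[OF T(1)[unfolded U] n(2)])
        show "terminal_item F i" if "i \<in># U" for i using terminal that U by simp
        show "\<nexists>xs. successively (linked_in F (over F (tops (add_mset (Part {#n#} C) U)))) (n # xs @ [n]) \<and>
            distinct (n # xs) \<and> 2 \<le> length xs" using noc unfolding U .
      qed blast
      note occ = occurs_children(4)[OF n(2)]
      have mem: "item_member F (Part {#n#} C) = TreeM (Exp {#Tensor t s#}) C" using n(2) by (simp add: wit_at)
      obtain \<Gamma> where "typed_tree \<Gamma> (Exp {#Tensor t s#}) C"
        using annT mem U unfolding e_annotated_sequent_iff by auto
      then obtain A B where AB: "C = And A B" by (auto elim!: typed_ExpE typed_TensorE)
      define V1 where "V1 = add_mset (Whole (Succ n LeftS) A) S1"
      define V2 where "V2 = add_mset (Whole (Succ n RightS) B) S2"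
      let ?V = "{#Whole (Succ n LeftS) A, Whole (Succ n RightS) B#}"
      have seqV: "sequent F ?V = {#TreeM t A, TreeM s B#}" using occ by (auto simp: tree_at)
      have V12: "V1 + V2 = U + ?V" unfolding V1_def V2_def S12 by simp
      have seq: "sequent F V1 = sequent F S1 + {#TreeM t A#}" "sequent F V2 = sequent F S2 + {#TreeM s B#}"
        unfolding V1_def V2_def using occ by (auto simp: tree_at)
      have sl: "slice F (U + ?V)" "over F (tops (U + ?V)) \<subseteq> over F (tops T)"
      proof -
        have "item_ok F j" if "j \<in># ?V" for j using that occ by auto
        moreover have "covers (tops ?V) m \<le> covers (item_tops (Part {#n#} C)) m" for m
          using covers_children[of F n m] unfolding children_simps(6)[OF n(2)] by simp
        ultimately show "slice F (U + ?V)" "over F (tops (U + ?V)) \<subseteq> over F (tops T)"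
          using slice_replace_top[OF T(1)[unfolded U], of ?V] unfolding U by blast+
      qed
      have ann12: "e_annotated_sequent (sequent F (V1 + V2))"
      proof -
        have "e_annotated_sequent (sequent F U + sequent F ?V)"
        proof (rule e_annotated_replace[of _ "{#TreeM (Exp {#Tensor t s#}) C#}"])
          show "e_annotated_sequent (sequent F U + {#TreeM (Exp {#Tensor t s#}) C#})"
            using annT mem unfolding U by simp
          show "wires (sequent F ?V) = wires {#TreeM (Exp {#Tensor t s#}) C#}" unfolding seqV by simp
          show "sequent F ?V \<noteq> {#}" by simp
          show "typed_sequent \<Delta> (sequent F ?V)" if "typed_sequent \<Delta> {#TreeM (Exp {#Tensor t s#}) C#}" for \<Delta>
            using that unfolding seqV AB by (auto elim!: typed_ExpE typed_TensorE)
        qed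
        then show ?thesis unfolding V12 by simp
      qed
      have sl12: "slice F V1" "slice F V2" using slice_sub[of F V1 V2] sl(1) unfolding V12 by auto
      have ok12: "item_ok F i" if "i \<in># V1 + V2" for i using slice_ok[OF sl(1)] that unfolding V12 by blast
      have sep12: "\<not> linked F u v" if "u \<in> over F (tops V1)" "v \<in> over F (tops V2)" for u v
        using sep that unfolding V1_def V2_def by simp
      have ann1: "e_annotated_sequent (sequent F V1)"
        by (rule e_annotated_separated[OF ann12 ok12 sep12]) (simp_all add: V1_def)
      have ann2: "e_annotated_sequent (sequent F V2)"
      proof (rule e_annotated_separated[of F V2 V1])
        show "e_annotated_sequent (sequent F (V2 + V1))" using ann12 by (simp add: add.commute)
        show "item_ok F i" if "i \<in># V2 + V1" for i using ok12 that by (simp add: disj_commute)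
        show "\<not> linked F u v" if "u \<in> over F (tops V2)" "v \<in> over F (tops V1)" for u v
          using sep12 that linked_sym by blast
        show "V2 \<noteq> {#}" by (simp add: V2_def)
      qed
      have over12: "over F (tops V1) \<subseteq> over F (tops T)" "over F (tops V2) \<subseteq> over F (tops T)"
        using sl(2) unfolding V12[symmetric] by auto
      have wt: "weight (sequent F T) = weight (sequent F S1) + weight (sequent F S2) + tree_weight t + tree_weight s + 1"
        using mem unfolding U S12 by simp
      have "LK_e (sequent F V1)"
        by (rule IH[OF _ sl12(1) ann1 over12(1)]) (simp add: wt seq del: image_mset_union)
      moreover have "LK_e (sequent F V2)"
        by (rule IH[OF _ sl12(2) ann2 over12(2)]) (simp add: wt seq del: image_mset_union)
      moreover have "set_mset (wires (sequent F V1)) \<inter> set_mset (wires (sequent F V2)) = {}"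
      proof (intro equals0I)
        fix v assume "v \<in> set_mset (wires (sequent F V1)) \<inter> set_mset (wires (sequent F V2))"
        then have "count (wires (sequent F V1)) v \<ge> 1" "count (wires (sequent F V2)) v \<ge> 1" by auto
        moreover have "count (wires (sequent F (V1 + V2))) v \<le> 1"
          using ann12 unfolding e_annotated_sequent_iff by blast
        ultimately show False unfolding image_mset_union wires_simps(2) count_union by linarith
      qed
      ultimately have "LK_e (sequent F S1 + sequent F S2 + {#TreeM (Exp {#Tensor t s#}) (And A B)#})"
        unfolding seq by (rule LK_e.and)
      then show ?thesis using mem unfolding U S12 AB by simp
    qed
  qed
  then show ?case using T(2) by simp
qed

section \<open>Derivability and AC-correctness\<close>

text \<open>
  The second equation is a default for nodes that are not the roots of trees.
\<close>
fun root_item :: "('a, 'x) node \<Rightarrow> ('a, 'x) item" where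
  "root_item (Root (TreeM t A) k) = Whole (Root (TreeM t A) k) A"
| "root_item n = Whole n Top"

lemma whole_forest_slice:
  assumes "e_annotated_sequent F"
  obtains S where "slice F S" "sequent F S = F" "over F (tops S) = nodes F"
proof -
  let ?R = "{Root m k | m k. k < count F m}"
  define S where "S = image_mset root_item (mset_set ?R)"
  have tree: "\<exists>t A. m = TreeM t A" if "m \<in># F" for m
    using assms that unfolding e_annotated_sequent_def by blast
  have item: "item_member F (root_item (Root m k)) = m \<and> item_ok F (root_item (Root m k))"
    if k: "k < count F m" for m k
  proof -
    have "m \<in># F" using k by (metis count_inI not_less_zero)
    then obtain t A where m: "m = TreeM t A" using tree by blast
    have "occurs F (Root m k) (TreeS t)" using k m by (simp add: occurs_Root_iff)
    then show ?thesis using m by (auto simp: tree_at)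
  qed
  have fin: "finite ?R" and seq: "image_mset (\<lambda>n. item_member F (root_item n)) (mset_set ?R) = F"
    using image_mset_copies[of Root F "\<lambda>n. item_member F (root_item n)"] item by auto
  have tops_root: "item_tops (root_item n) = {#n#}" for n by (cases n rule: root_item.cases) auto
  have tops: "tops S = mset_set ?R"
    unfolding S_def by (simp add: multiset.map_comp comp_def tops_root)
  show ?thesis
  proof (rule that)
    show "slice F S"
    proof (rule sliceI)
      show "item_ok F i" if "i \<in># S" for i using that item fin unfolding S_def by auto
      have uniq: "x = y" if "x \<in> ?R" "y \<in> ?R" "x \<in> anc m" "y \<in> anc m" for x y m
        using anc_chain[OF that(3,4)] that(1,2) by auto
      have "finite {x \<in> ?R. x \<in> anc m}" for m using fin by (rule rev_finite_subset) blast
      then have "card {x \<in> ?R. x \<in> anc m} \<le> Suc 0" for m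
        using uniq by (subst card_le_Suc0_iff_eq) blast+
      then show "covers (tops S) m \<le> 1" for m unfolding tops covers_def using fin by simp
    qed
    show "sequent F S = F" unfolding S_def using seq by (simp add: multiset.map_comp comp_def)
    show "over F (tops S) = nodes F"
    proof (rule antisym[OF over_nodes subsetI])
      fix n assume n: "n \<in> nodes F"
      obtain m k where mk: "Root m k \<in> anc n" using root_in_anc by blast
      then have "Root m k \<in> nodes F" using n anc_nodes by blast
      then have "k < count F m" by (auto simp: nodes_def occurs_Root_iff)
      then have "Root m k \<in># tops S" unfolding tops using fin by auto
      then show "n \<in> over F (tops S)" using mk n unfolding over_def below_def by blast
    qed
  qed
qed

theorem theorem49:
  fixes F :: "('a::countable, 'x) forest"
  assumes "e_annotated_sequent F"
  shows "expansion_net F \<longleftrightarrow> AC_correct F"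
proof -
  obtain S where S: "slice F S" "sequent F S = F" "over F (tops S) = nodes F"
    using whole_forest_slice[OF assms] .
  show ?thesis
  proof
    assume "expansion_net F"
    then have "acyclic_slices F F" using acyclic_slices_if_LK_e unfolding expansion_net_def by blast
    then have "acyclic_on F (nodes F)" using acyclic_slicesD[OF _ S(1,2)] S(3) by simp
    then show "AC_correct F" by (rule AC_correct_if_acyclic)
  next
    assume "AC_correct F"
    then have "acyclic_on F (nodes F)" using switched_successors[OF assms] by (rule acyclic_if_AC_correct)
    then have "LK_e (sequent F S)" using LK_e_if_acyclic[OF S(1)] S assms by simp
    then show "expansion_net F" using S(2) assms by (simp add: expansion_net_def)
  qed
qed

end
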